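(* Let $\ell\in\mathbb{C}$ with $\ell\ne -2,0,1,4$, and put $$A_1=\operatorname{diag}\Big(\tfrac{1}{2\ell},0,0\Big),\qquad A_4=\operatorname{diag}\Big(-\tfrac{1}{\ell(\ell+2)},\tfrac{1}{2(\ell+2)},\tfrac{1}{2(\ell+2)}\Big).$$ Then $$\operatorname{Sc}(V_{\widehat{\mathfrak{sl}}_2}(\ell,0),\omega)=\operatorname{Orb}_{A_1}\cup\operatorname{Orb}_{A_4}\cup\{0\}\cup\{\omega\}.$$ In particular, when $\ell$ is a positive integer with $\ell\notin\{1,4\}$, $$\operatorname{Sc}(L_{\widehat{\mathfrak{sl}}_2}(\ell,0),\omega)=\operatorname{Orb}_{A_1}\cup\operatorname{Orb}_{A_4}\cup\{0\}\cup\{\omega\}.$$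
   Context: On $\mathfrak{sl}_2=\mathfrak{sl}_2(\mathbb{C})$ with standard basis $h,e,f$ use the normalized Killing form $\langle h,h\rangle=2$, $\langle e,f\rangle=1$, all other pairings of basis elements being $0$. An orthonormal basis is $\alpha_1=\frac{e+f}{\sqrt2}$, $\alpha_2=\frac{e-f}{\sqrt{-2}}$, $\alpha_3=\frac{h}{\sqrt2}$. $\widehat{\mathfrak{sl}}_2=\mathfrak{sl}_2\otimes\mathbb{C}[t,t^{-1}]\oplus\mathbb{C}K$, $a(n)=a\otimes t^n$, $[a(n),b(m)]=[a,b](n+m)+n\delta_{n+m,0}\langle a,b\rangle K$, $K$ central. $V_{\widehat{\mathfrak{sl}}_2}(\ell,0)$ is the universal affine vertex operator algebra of level $\ell\ne-2$ (induced from the one-dimensional module $\mathbb{C}\mathbf{1}$ of $\mathfrak{sl}_2\otimes\mathbb{C}[t]\oplus\mathbb{C}K$ on which $\mathfrak{sl}_2\otimes\mathbb{C}[t]$ acts by $0$ and $K$ by $\ell$), with conformal vector $\omega=\frac{1}{2(\ell+2)}\sum_{i=1}^3\alpha_i(-1)^2\mathbf{1}$; $L_{\widehat{\mathfrak{sl}}_2}(\ell,0)$ is its simple quotient, with conformal vector the image of $\omega$, again denoted $\omega$. For a vertex operator algebra $(V,\omega)$ write $Y(v,z)=\sum_n v_nz^{-n-1}$. A vector $\omega'\in V$ is semi-conformal if there is a vertex subalgebra $U\subseteq V$ such that $(U,\omega')$ is a vertex operator algebra with conformal vector $\omega'$ and $\omega'_n|_U=\omega_n|_U$ for all $n\ge0$;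 $\operatorname{Sc}(V,\omega)$ is the set of semi-conformal vectors. For a complex symmetric $3\times3$ matrix $A=(a_{ij})$ put $\omega_A=\sum_{i,j} a_{ij}\alpha_i(-1)\alpha_j(-1)\mathbf{1}$ (in $L_{\widehat{\mathfrak{sl}}_2}(\ell,0)$, the image of this vector), and $\operatorname{Orb}_{A}=\{\omega_B\mid B=oAo^{tr},\ o\in\operatorname{SO}_3(\mathbb{C})\}$. *)

theory Defs
  imports "HOL-Analysis.Analysis" "HOL-Library.Poly_Mapping"
begin

section \<open>Vertex (operator) algebras\<close>

text \<open>
  A vertex algebra lives on a subspace \<open>V\<close> of an ambient complex vector space, so that
  vertex subalgebras are literally subsets with the same operations.  \<open>Y u n v\<close> is the
  mode \<open>u\<^sub>n v\<close>, i.e. \<open>Y(u,z) v = \<Sum>\<^sub>n u\<^sub>n v z\<^bsup>-n-1\<^esup>\<close>.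
  The Jacobi identity is stated in its component form (the Borcherds identity)
  \<open>\<Sum>\<^sub>i (m choose i) (a\<^sub>n\<^sub>+\<^sub>i b)\<^sub>m\<^sub>+\<^sub>k\<^sub>-\<^sub>i c
     = \<Sum>\<^sub>i (-1)\<^sup>i (n choose i) (a\<^sub>m\<^sub>+\<^sub>n\<^sub>-\<^sub>i b\<^sub>k\<^sub>+\<^sub>i c - (-1)\<^sup>n b\<^sub>n\<^sub>+\<^sub>k\<^sub>-\<^sub>i a\<^sub>m\<^sub>+\<^sub>i c)\<close>.
  By truncation only finitely many summands are nonzero, so that the identity says that the
  partial sums of both sides agree from some point on.
\<close>

locale vertex_algebra = vector_space smul
  for smul :: "complex \<Rightarrow> 'v::ab_group_add \<Rightarrow> 'v" +
  fixes V :: "'v set" and Y :: "'v \<Rightarrow> int \<Rightarrow> 'v \<Rightarrow> 'v" and vac :: 'v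
  assumes carrier_subspace: "subspace V"
    and vac_closed: "vac \<in> V"
    and mode_closed: "\<lbrakk>u \<in> V; v \<in> V\<rbrakk> \<Longrightarrow> Y u n v \<in> V"
    and mode_add_left: "\<lbrakk>u \<in> V; u' \<in> V; v \<in> V\<rbrakk> \<Longrightarrow> Y (u + u') n v = Y u n v + Y u' n v"
    and mode_scale_left: "\<lbrakk>u \<in> V; v \<in> V\<rbrakk> \<Longrightarrow> Y (smul s u) n v = smul s (Y u n v)"
    and mode_add_right: "\<lbrakk>u \<in> V; v \<in> V; v' \<in> V\<rbrakk> \<Longrightarrow> Y u n (v + v') = Y u n v + Y u n v'"
    and mode_scale_right: "\<lbrakk>u \<in> V; v \<in> V\<rbrakk> \<Longrightarrow> Y u n (smul s v) = smul s (Y u n v)"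
    and truncation: "\<lbrakk>u \<in> V; v \<in> V\<rbrakk> \<Longrightarrow> \<exists>N. \<forall>n\<ge>N. Y u n v = 0"
    and vacuum: "v \<in> V \<Longrightarrow> Y vac n v = (if n = -1 then v else 0)"
    and creation_nonneg: "\<lbrakk>v \<in> V; n \<ge> 0\<rbrakk> \<Longrightarrow> Y v n vac = 0"
    and creation: "v \<in> V \<Longrightarrow> Y v (-1) vac = v"
    and borcherds: "\<lbrakk>a \<in> V; b \<in> V; c \<in> V\<rbrakk> \<Longrightarrow> \<exists>N. \<forall>M\<ge>N.
      (\<Sum>i<M. smul (of_int m gchoose i)
         (Y (Y a (n + int i) b) (m + k - int i) c)) =
      (\<Sum>i<M. smul ((-1) ^ i * (of_int n gchoose i))
         (Y a (m + n - int i) (Y b (k + int i) c)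
          - smul ((-1) powi n) (Y b (n + k - int i) (Y a (m + int i) c))))"

locale vertex_operator_algebra = vertex_algebra smul V Y vac
  for smul :: "complex \<Rightarrow> 'v::ab_group_add \<Rightarrow> 'v" and V Y vac +
  fixes \<omega> :: 'v
  assumes conformal_closed: "\<omega> \<in> V"
    \<comment> \<open>\<open>L(n) = \<omega>\<^sub>n\<^sub>+\<^sub>1\<close>; here \<open>c\<close> is the central charge\<close>
    and virasoro: "\<exists>c. \<forall>m n. \<forall>v\<in>V.
      Y \<omega> (m + 1) (Y \<omega> (n + 1) v) - Y \<omega> (n + 1) (Y \<omega> (m + 1) v) =
      smul (of_int (m - n)) (Y \<omega> (m + n + 1) v)
      + smul (if m + n = 0 then of_int (m ^ 3 - m) / 12 * c else 0) v"
    \<comment> \<open>\<open>Y(L(-1) u, z) = d/dz Y(u, z)\<close>\<close>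
    and L_minus1_derivative: "\<lbrakk>u \<in> V; v \<in> V\<rbrakk> \<Longrightarrow>
      Y (Y \<omega> 0 u) n v = smul (- of_int n) (Y u (n - 1) v)"
    \<comment> \<open>\<open>V\<close> is the (automatically direct) sum of the integral eigenspaces of \<open>L(0)\<close>\<close>
    and grading: "V = span (\<Union>n::int. {v \<in> V. Y \<omega> 1 v = smul (of_int n) v})"
    and grading_finite: "\<exists>B. finite B \<and> {v \<in> V. Y \<omega> 1 v = smul (of_int (n::int)) v} \<subseteq> span B"
    and grading_bounded: "\<exists>N::int. \<forall>n<N. {v \<in> V. Y \<omega> 1 v = smul (of_int n) v} = {0}"

definition vertex_subalgebra ::
  "(complex \<Rightarrow> 'v::ab_group_add \<Rightarrow> 'v) \<Rightarrow> 'v set \<Rightarrow> ('v \<Rightarrow> int \<Rightarrow> 'v \<Rightarrow> 'v) \<Rightarrow> 'v \<Rightarrow> 'v set \<Rightarrow> bool"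
where
  "vertex_subalgebra smul V Y vac U \<longleftrightarrow>
     U \<subseteq> V \<and> module.subspace smul U \<and> vac \<in> U \<and> (\<forall>u\<in>U. \<forall>v\<in>U. \<forall>n. Y u n v \<in> U)"

definition Sc ::
  "(complex \<Rightarrow> 'v::ab_group_add \<Rightarrow> 'v) \<Rightarrow> 'v set \<Rightarrow> ('v \<Rightarrow> int \<Rightarrow> 'v \<Rightarrow> 'v) \<Rightarrow> 'v \<Rightarrow> 'v \<Rightarrow> 'v set"
where
  "Sc smul V Y vac \<omega> =
     {\<omega>' \<in> V. \<exists>U. vertex_subalgebra smul V Y vac U
        \<and> vertex_operator_algebra smul U Y vac \<omega>'
        \<and> (\<forall>n\<ge>0. \<forall>u\<in>U. Y \<omega>' n u = Y \<omega> n u)}"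

definition va_ideal ::
  "(complex \<Rightarrow> 'v::ab_group_add \<Rightarrow> 'v) \<Rightarrow> 'v set \<Rightarrow> ('v \<Rightarrow> int \<Rightarrow> 'v \<Rightarrow> 'v) \<Rightarrow> 'v set \<Rightarrow> bool"
where
  "va_ideal smul V Y I \<longleftrightarrow>
     I \<subseteq> V \<and> module.subspace smul I \<and> (\<forall>v\<in>V. \<forall>u\<in>I. \<forall>n. Y v n u \<in> I \<and> Y u n v \<in> I)"

definition simple_va ::
  "(complex \<Rightarrow> 'v::ab_group_add \<Rightarrow> 'v) \<Rightarrow> 'v set \<Rightarrow> ('v \<Rightarrow> int \<Rightarrow> 'v \<Rightarrow> 'v) \<Rightarrow> bool"
where
  "simple_va smul V Y \<longleftrightarrow> V \<noteq> {0} \<and> (\<forall>I. va_ideal smul V Y I \<longrightarrow> I = {0} \<or> I = V)"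

text \<open>
  \<open>\<pi>\<close> exhibits the vertex algebra \<open>(smul', Y', vac')\<close> as a simple quotient of
  \<open>(smul, Y, vac)\<close>: it is the quotient by the ideal \<open>ker \<pi>\<close>.
\<close>

definition simple_quotient ::
  "(complex \<Rightarrow> 'v::ab_group_add \<Rightarrow> 'v) \<Rightarrow> ('v \<Rightarrow> int \<Rightarrow> 'v \<Rightarrow> 'v) \<Rightarrow> 'v \<Rightarrow>
   (complex \<Rightarrow> 'w::ab_group_add \<Rightarrow> 'w) \<Rightarrow> ('w \<Rightarrow> int \<Rightarrow> 'w \<Rightarrow> 'w) \<Rightarrow> 'w \<Rightarrow> ('v \<Rightarrow> 'w) \<Rightarrow> bool"
where
  "simple_quotient smul Y vac smul' Y' vac' \<pi> \<longleftrightarrow>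
     vertex_algebra smul' UNIV Y' vac' \<and> simple_va smul' UNIV Y'
     \<and> Vector_Spaces.linear smul smul' \<pi> \<and> surj \<pi> \<and> \<pi> vac = vac'
     \<and> (\<forall>u n v. \<pi> (Y u n v) = Y' (\<pi> u) n (\<pi> v))"


section \<open>The Lie algebra \<open>sl\<^sub>2\<close>\<close>

text \<open>Elements of \<open>sl\<^sub>2\<close> are given by their coordinates with respect to \<open>h, e, f\<close> (in this order).\<close>

type_synonym sl2 = "complex ^ 3"

definition sl2_h :: sl2 where "sl2_h = vector [1, 0, 0]"
definition sl2_e :: sl2 where "sl2_e = vector [0, 1, 0]"
definition sl2_f :: sl2 where "sl2_f = vector [0, 0, 1]"

definition sl2_bracket :: "sl2 \<Rightarrow> sl2 \<Rightarrow> sl2" where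
  "sl2_bracket a b = vector
     [a$2 * b$3 - a$3 * b$2, 2 * (a$1 * b$2 - a$2 * b$1), 2 * (a$3 * b$1 - a$1 * b$3)]"

definition sl2_form :: "sl2 \<Rightarrow> sl2 \<Rightarrow> complex" where
  "sl2_form a b = 2 * a$1 * b$1 + a$2 * b$3 + a$3 * b$2"

text \<open>Bracket and form are the commutator and the trace form of traceless \<open>2 \<times> 2\<close> matrices.\<close>

definition sl2_matrix :: "sl2 \<Rightarrow> complex ^ 2 ^ 2" where
  "sl2_matrix a = vector [vector [a$1, a$2], vector [a$3, - a$1]]"

lemma sl2_matrix_bracket:
  "sl2_matrix (sl2_bracket a b) = sl2_matrix a ** sl2_matrix b - sl2_matrix b ** sl2_matrix a"
  by (simp add: vec_eq_iff forall_2 matrix_matrix_mult_def sum_2 sl2_matrix_def sl2_bracket_def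
      algebra_simps)

lemma sl2_matrix_form: "sl2_form a b = trace (sl2_matrix a ** sl2_matrix b)"
  by (simp add: trace_def matrix_matrix_mult_def sum_2 sl2_matrix_def sl2_form_def algebra_simps)

lemma range_sl2_matrix: "range sl2_matrix = {A. trace A = 0}"
proof -
  have "A = sl2_matrix (vector [A$1$1, A$1$2, A$2$1])" if "trace A = 0" for A :: "complex^2^2"
  proof -
    have "A$2$2 = - A$1$1"
      using that by (simp add: trace_def sum_2 add_eq_0_iff)
    then show ?thesis
      by (simp add: vec_eq_iff forall_2 sl2_matrix_def)
  qed
  moreover have "trace (sl2_matrix a) = 0" for a
    by (simp add: trace_def sum_2 sl2_matrix_def)
  ultimately show ?thesis by blast
qed

text \<open>The orthonormal basis \<open>\<alpha>\<^sub>1, \<alpha>\<^sub>2, \<alpha>\<^sub>3\<close>.\<close>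

definition alpha :: "3 \<Rightarrow> sl2" where
  "alpha i = (vector [(1 / csqrt 2) *s (sl2_e + sl2_f),
                      (1 / csqrt (-2)) *s (sl2_e - sl2_f),
                      (1 / csqrt 2) *s sl2_h] :: sl2 ^ 3) $ i"

lemma alpha_orthonormal: "sl2_form (alpha i) (alpha j) = (if i = j then 1 else 0)"
proof -
  have 1: "csqrt 2 * csqrt 2 = 2" "csqrt (-2) * csqrt (-2) = -2"
    using power2_csqrt[of 2] power2_csqrt[of "-2"] by (simp_all only: power2_eq_square)
  then have 2: "csqrt 2 \<noteq> 0" "csqrt (-2) \<noteq> 0" by auto
  show ?thesis
    using exhaust_3[of i] exhaust_3[of j] 1 2
    by (elim disjE; simp add: alpha_def sl2_form_def sl2_h_def sl2_e_def sl2_f_def field_simps)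
qed


section \<open>The vacuum module of the affine Lie algebra\<close>

text \<open>
  The universal enveloping algebra of the affine Lie algebra is the free associative algebra on
  the symbols \<open>a(n) = Cur a n\<close> and \<open>K = Ctr\<close>, modulo linearity in \<open>a\<close> and the commutation
  relations.  The free algebra is the space of finitely supported functions on words.
\<close>

datatype affine_gen = Cur sl2 int | Ctr

type_synonym affine_free = "affine_gen list \<Rightarrow>\<^sub>0 complex"

definition free_scale :: "complex \<Rightarrow> affine_free \<Rightarrow> affine_free" where
  "free_scale c p = Poly_Mapping.map ((*) c) p"

lemma lookup_free_scale: "Poly_Mapping.lookup (free_scale c p) w = c * Poly_Mapping.lookup p w"
  unfolding free_scale_def by (transfer; simp add: when_def)

lemma vector_space_free_scale: "vector_space free_scale"
  by (unfold_locales;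
      rule poly_mapping_eqI; simp add: lookup_free_scale lookup_add algebra_simps)

abbreviation word :: "affine_gen list \<Rightarrow> affine_free" where
  "word w \<equiv> Poly_Mapping.single w 1"

text \<open>
  The induced module \<open>U(\<ghat>) \<otimes> \<complex>\<one>\<close> is the quotient of the free algebra by the span of the
  following elements: the first three families span the two-sided ideal defining the enveloping
  algebra, the last two generate (as a left ideal) the relations \<open>a(n) \<one> = 0\<close> for \<open>n \<ge> 0\<close>
  and \<open>K \<one> = l \<one>\<close>.
\<close>

definition vacuum_relations :: "complex \<Rightarrow> affine_free set" where
  "vacuum_relations l =
     {word (u @ [Cur (x *s a + y *s b) n] @ w)
        - free_scale x (word (u @ [Cur a n] @ w)) - free_scale y (word (u @ [Cur b n] @ w))
        | u w a b x y n. True}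
   \<union> {word (u @ [Cur a m, Cur b n] @ w) - word (u @ [Cur b n, Cur a m] @ w)
        - word (u @ [Cur (sl2_bracket a b) (m + n)] @ w)
        - free_scale (if m + n = 0 then of_int m * sl2_form a b else 0) (word (u @ [Ctr] @ w))
        | u w a b m n. True}
   \<union> {word (u @ [Ctr, Cur a n] @ w) - word (u @ [Cur a n, Ctr] @ w) | u w a n. True}
   \<union> {word (u @ [Cur a n]) | u a n. n \<ge> 0}
   \<union> {word (u @ [Ctr]) - free_scale l (word u) | u. True}"

definition vacuum_ideal :: "complex \<Rightarrow> affine_free set" where
  "vacuum_ideal l = module.span free_scale (vacuum_relations l)"


section \<open>The universal affine vertex algebra\<close>

text \<open>
  Given a vertex algebra with a map \<open>\<iota>\<close> from \<open>sl\<^sub>2\<close> (to be thought of as \<open>a \<mapsto> a(-1)\<one>\<close>),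
  let \<open>a(n)\<close> act as the mode \<open>(\<iota> a)\<^sub>n\<close> and \<open>K\<close> as \<open>l\<close>.  Words, and hence elements of the free
  algebra, are evaluated on the vacuum.
\<close>

fun gen_act :: "complex \<Rightarrow> (complex \<Rightarrow> 'v::ab_group_add \<Rightarrow> 'v) \<Rightarrow> ('v \<Rightarrow> int \<Rightarrow> 'v \<Rightarrow> 'v) \<Rightarrow>
    (sl2 \<Rightarrow> 'v) \<Rightarrow> affine_gen \<Rightarrow> 'v \<Rightarrow> 'v" where
  "gen_act l smul Y \<iota> (Cur a n) v = Y (\<iota> a) n v"
| "gen_act l smul Y \<iota> Ctr v = smul l v"

definition vacuum_eval :: "complex \<Rightarrow> (complex \<Rightarrow> 'v::ab_group_add \<Rightarrow> 'v) \<Rightarrow>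
    ('v \<Rightarrow> int \<Rightarrow> 'v \<Rightarrow> 'v) \<Rightarrow> 'v \<Rightarrow> (sl2 \<Rightarrow> 'v) \<Rightarrow> affine_free \<Rightarrow> 'v" where
  "vacuum_eval l smul Y vac \<iota> p =
     (\<Sum>w\<in>Poly_Mapping.keys p.
        smul (Poly_Mapping.lookup p w) (foldr (gen_act l smul Y \<iota>) w vac))"

text \<open>
  The universal affine vertex algebra of level \<open>l\<close>, as a structure determined up to unique
  isomorphism: its underlying module for the affine Lie algebra is the induced one (evaluation on
  the vacuum identifies it with the quotient of the free algebra by \<open>vacuum_ideal l\<close>), and its
  vertex algebra structure is the unique one with vacuum \<open>\<one>\<close> and
  \<open>Y(a(-1)\<one>, z) = \<Sum>\<^sub>n a(n) z\<^bsup>-n-1\<^esup>\<close> (existence and uniqueness: Frenkel--Zhu).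
  That \<open>\<iota> a = a(-1)\<one>\<close> is the creation axiom.
\<close>

locale universal_affine_vertex_algebra = vertex_algebra smul UNIV Y vac
  for smul :: "complex \<Rightarrow> 'v::ab_group_add \<Rightarrow> 'v" and Y vac +
  fixes l :: complex and \<iota> :: "sl2 \<Rightarrow> 'v"
  assumes vacuum_eval_surj: "range (vacuum_eval l smul Y vac \<iota>) = UNIV"
    and vacuum_eval_kernel: "vacuum_eval l smul Y vac \<iota> p = 0 \<longleftrightarrow> p \<in> vacuum_ideal l"


section \<open>The vectors \<open>\<omega>\<^sub>A\<close> and their orbits\<close>

definition omega_mat :: "(complex \<Rightarrow> 'v::ab_group_add \<Rightarrow> 'v) \<Rightarrow> ('v \<Rightarrow> int \<Rightarrow> 'v \<Rightarrow> 'v) \<Rightarrow>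
    'v \<Rightarrow> (sl2 \<Rightarrow> 'v) \<Rightarrow> complex ^ 3 ^ 3 \<Rightarrow> 'v" where
  "omega_mat smul Y vac \<iota> A =
     (\<Sum>i\<in>UNIV. \<Sum>j\<in>UNIV. smul (A$i$j) (Y (\<iota> (alpha i)) (-1) (Y (\<iota> (alpha j)) (-1) vac)))"

definition affine_omega :: "(complex \<Rightarrow> 'v::ab_group_add \<Rightarrow> 'v) \<Rightarrow> ('v \<Rightarrow> int \<Rightarrow> 'v \<Rightarrow> 'v) \<Rightarrow>
    'v \<Rightarrow> complex \<Rightarrow> (sl2 \<Rightarrow> 'v) \<Rightarrow> 'v" where
  "affine_omega smul Y vac l \<iota> =
     smul (1 / (2 * (l + 2)))
       (\<Sum>i\<in>UNIV. Y (\<iota> (alpha i)) (-1) (Y (\<iota> (alpha i)) (-1) vac))"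

definition SO3 :: "(complex ^ 3 ^ 3) set" where
  "SO3 = {Q. orthogonal_matrix Q \<and> det Q = 1}"

definition omega_orbit :: "(complex \<Rightarrow> 'v::ab_group_add \<Rightarrow> 'v) \<Rightarrow> ('v \<Rightarrow> int \<Rightarrow> 'v \<Rightarrow> 'v) \<Rightarrow>
    'v \<Rightarrow> (sl2 \<Rightarrow> 'v) \<Rightarrow> complex ^ 3 ^ 3 \<Rightarrow> 'v set" where
  "omega_orbit smul Y vac \<iota> A =
     {omega_mat smul Y vac \<iota> B | B. \<exists>Q\<in>SO3. B = Q ** A ** transpose Q}"

definition diag3 :: "complex \<Rightarrow> complex \<Rightarrow> complex \<Rightarrow> complex ^ 3 ^ 3" where
  "diag3 x y z = vector [vector [x, 0, 0], vector [0, y, 0], vector [0, 0, z]]"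

definition A1 :: "complex \<Rightarrow> complex ^ 3 ^ 3" where
  "A1 l = diag3 (1 / (2 * l)) 0 0"

definition A4 :: "complex \<Rightarrow> complex ^ 3 ^ 3" where
  "A4 l = diag3 (- 1 / (l * (l + 2))) (1 / (2 * (l + 2))) (1 / (2 * (l + 2)))"

end

theory Submission
  imports Defs
begin

text \<open>
  A vector \<open>u\<close> is semi-conformal if and only if \<open>\<omega>\<^sub>1 u = 2 u\<close>, \<open>\<omega>\<^sub>2 u = 0\<close> and \<open>u\<^sub>1 u = 2 u\<close>: skew
  symmetry and the commutator formula then give \<open>u\<^sub>i u = \<omega>\<^sub>i u\<close> for all \<open>i \<ge> 0\<close>, so that \<open>\<omega>\<close> and \<open>u\<close>
  have the same nonnegative modes on the span of all \<open>u\<^sub>n \<dots> u\<^sub>m \<one>\<close>, which is a vertex operator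
  algebra with conformal vector \<open>u\<close>.
  A vector of weight 2 is \<open>\<omega>\<^sub>A + x(-2)\<one>\<close> with \<open>A\<close> symmetric; \<open>\<omega>\<^sub>2\<close> kills the second summand only if
  \<open>x = 0\<close>, and with \<open>t = tr A\<close> and \<open>s = tr A\<^sup>2\<close>
  \<open>(\<omega>\<^sub>A)\<^sub>1 \<omega>\<^sub>A = \<omega>\<^sub>B\<close> for \<open>B = 4 (l - 4) A\<^sup>2 + 16 t A - 4 (t\<^sup>2 - s)\<close>.
  The form \<open>\<alpha>\<^sub>q(1) \<alpha>\<^sub>p(1) \<omega>\<^sub>A\<close> is nondegenerate on symmetric matrices if \<open>l\<close> is not \<open>-2, 0, 1\<close>, in every
  nonzero quotient as well, so the problem is to solve \<open>B = 2 A\<close>. By the Cayley-Hamilton theorem a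
  nonscalar solution is \<open>\<mu> + (\<lambda> - \<mu>) P\<close> with \<open>P\<close> a symmetric idempotent of trace 1, i.e. \<open>P = v v\<^sup>T\<close> with
  \<open>v\<^sup>T v = 1\<close>, and the trace leaves exactly the two possibilities for \<open>(\<lambda>, \<mu>)\<close> in \<open>A\<^sub>1\<close> and \<open>A\<^sub>4\<close>.
\<close>

section \<open>Semi-conformal vectors\<close>

locale full_vertex_algebra = vertex_algebra smul UNIV Y vac
  for smul :: "complex \<Rightarrow> 'v::ab_group_add \<Rightarrow> 'v" and Y :: "'v \<Rightarrow> int \<Rightarrow> 'v \<Rightarrow> 'v" and vac
begin

lemma Y_add_left: "Y (u + u') n v = Y u n v + Y u' n v"
  by (simp add: mode_add_left)

lemma Y_add_right: "Y u n (v + v') = Y u n v + Y u n v'"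
  by (simp add: mode_add_right)

lemma Y_scale_left: "Y (smul s u) n v = smul s (Y u n v)"
  by (simp add: mode_scale_left)

lemma Y_scale_right: "Y u n (smul s v) = smul s (Y u n v)"
  by (simp add: mode_scale_right)

lemma Y_zero_left [simp]: "Y 0 n v = 0"
  using Y_scale_left[of 0 0 n v] by simp

lemma Y_zero_right [simp]: "Y u n 0 = 0"
  using Y_scale_right[of u n 0 0] by simp

lemma Y_sum_left: "Y (\<Sum>i\<in>I. f i) n v = (\<Sum>i\<in>I. Y (f i) n v)"
  by (induction I rule: infinite_finite_induct) (simp_all add: Y_add_left)

lemma Y_sum_right: "Y u n (\<Sum>i\<in>I. f i) = (\<Sum>i\<in>I. Y u n (f i))"
  by (induction I rule: infinite_finite_induct) (simp_all add: Y_add_right)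

lemma Y_vac_left: "Y vac n v = (if n = -1 then v else 0)"
  by (simp add: vacuum)

lemma Y_vac_right [simp]: "n \<ge> 0 \<Longrightarrow> Y v n vac = 0"
  by (simp add: creation_nonneg)

lemma Y_creation [simp]: "Y v (-1) vac = v"
  by (simp add: creation)

lemma scale_two_cancel: "smul 2 x = smul 2 y \<Longrightarrow> x = y"
  by simp

lemma double_eq_scale: "x + x = smul 2 x"
  using scale_left_distrib[of 1 1 x] by simp

text \<open>The Borcherds identity with n = 0, where \<open>0 gchoose i\<close> leaves only i = 0 on
  the right. An explicit truncation bound \<open>K\<close> turns the eventual equality of partial
  sums into one finite identity; the same device serves the next specializations.\<close>

lemma mode_commutator:
  assumes K: "\<And>i. i \<ge> K \<Longrightarrow> Y a (int i) b = 0"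
  shows "Y a m (Y b k c) - Y b k (Y a m c)
    = (\<Sum>i<K. smul (of_int m gchoose i) (Y (Y a (int i) b) (m + k - int i) c))"
proof -
  obtain N where N: "\<And>M. M \<ge> N \<Longrightarrow>
      (\<Sum>i<M. smul (of_int m gchoose i) (Y (Y a (0 + int i) b) (m + k - int i) c)) =
      (\<Sum>i<M. smul ((-1) ^ i * (of_int 0 gchoose i))
         (Y a (m + 0 - int i) (Y b (k + int i) c)
          - smul ((-1) powi 0) (Y b (0 + k - int i) (Y a (m + int i) c))))"
    using borcherds[of a b c m 0 k] by auto
  define M where "M = max (max N K) 1"
  have "(\<Sum>i<K. smul (of_int m gchoose i) (Y (Y a (int i) b) (m + k - int i) c))
      = (\<Sum>i<M. smul (of_int m gchoose i) (Y (Y a (0 + int i) b) (m + k - int i) c))"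
    by (rule sum.mono_neutral_cong_left) (auto simp: M_def K)
  also have "\<dots> = (\<Sum>i<M. smul ((-1) ^ i * (of_int 0 gchoose i))
         (Y a (m + 0 - int i) (Y b (k + int i) c)
          - smul ((-1) powi 0) (Y b (0 + k - int i) (Y a (m + int i) c))))"
    by (rule N) (simp add: M_def)
  also have "\<dots> = (\<Sum>i\<in>{0}. smul ((-1) ^ i * (of_int 0 gchoose i))
         (Y a (m + 0 - int i) (Y b (k + int i) c)
          - smul ((-1) powi 0) (Y b (0 + k - int i) (Y a (m + int i) c))))"
    by (rule sum.mono_neutral_right) (auto simp: M_def gbinomial_0_left)
  also have "\<dots> = Y a m (Y b k c) - Y b k (Y a m c)" by simp
  finally show ?thesis by simp
qed

text \<open>For a nonnegative mode the binomials cut the sum off at \<open>m\<close>, whatever the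
  truncation of \<open>a\<close> on \<open>b\<close> is. Only products a_i b with i between 0 and m
  enter, which later allows two different vectors \<open>a\<close> to be compared.\<close>

lemma mode_commutator_nat:
  "Y a (int m) (Y b k c) - Y b k (Y a (int m) c)
    = (\<Sum>i\<le>m. smul (of_nat (m choose i)) (Y (Y a (int i) b) (int m + k - int i) c))"
proof -
  obtain N where N: "\<And>n. n \<ge> N \<Longrightarrow> Y a n b = 0" using truncation[of a b] by auto
  define K where "K = max (nat N) (Suc m)"
  have "Y a (int m) (Y b k c) - Y b k (Y a (int m) c)
    = (\<Sum>i<K. smul (of_int (int m) gchoose i) (Y (Y a (int i) b) (int m + k - int i) c))"
    by (rule mode_commutator) (auto simp: K_def N)
  also have "\<dots> = (\<Sum>i\<le>m. smul (of_nat (m choose i)) (Y (Y a (int i) b) (int m + k - int i) c))"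
    by (rule sum.mono_neutral_cong_right) (auto simp: K_def binomial_eq_0 simp flip: binomial_gbinomial)
  finally show ?thesis .
qed

text \<open>The Borcherds identity with m = 0, where \<open>0 gchoose i\<close> now leaves only i =
  0 on the left.\<close>

lemma mode_iterate:
  assumes K: "\<And>i. i \<ge> K \<Longrightarrow> Y b (k + int i) c = 0" "\<And>i. i \<ge> K \<Longrightarrow> Y a (int i) c = 0"
  shows "Y (Y a n b) k c = (\<Sum>i<K. smul ((-1) ^ i * (of_int n gchoose i))
    (Y a (n - int i) (Y b (k + int i) c) - smul ((-1) powi n) (Y b (n + k - int i) (Y a (int i) c))))"
proof -
  obtain N where N: "\<And>M. M \<ge> N \<Longrightarrow>
      (\<Sum>i<M. smul (of_int 0 gchoose i) (Y (Y a (n + int i) b) (0 + k - int i) c)) =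
      (\<Sum>i<M. smul ((-1) ^ i * (of_int n gchoose i))
         (Y a (0 + n - int i) (Y b (k + int i) c)
          - smul ((-1) powi n) (Y b (n + k - int i) (Y a (0 + int i) c))))"
    using borcherds[of a b c 0 n k] by auto
  define M where "M = max (max N K) 1"
  have "Y (Y a n b) k c =
      (\<Sum>i\<in>{0}. smul (of_int 0 gchoose i) (Y (Y a (n + int i) b) (0 + k - int i) c))" by simp
  also have "\<dots> = (\<Sum>i<M. smul (of_int 0 gchoose i) (Y (Y a (n + int i) b) (0 + k - int i) c))"
    by (rule sum.mono_neutral_left) (auto simp: M_def gbinomial_0_left)
  also have "\<dots> = (\<Sum>i<M. smul ((-1) ^ i * (of_int n gchoose i))
         (Y a (0 + n - int i) (Y b (k + int i) c)
          - smul ((-1) powi n) (Y b (n + k - int i) (Y a (0 + int i) c))))"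
    by (rule N) (simp add: M_def)
  also have "\<dots> = (\<Sum>i<K. smul ((-1) ^ i * (of_int n gchoose i))
    (Y a (n - int i) (Y b (k + int i) c) - smul ((-1) powi n) (Y b (n + k - int i) (Y a (int i) c))))"
    by (rule sum.mono_neutral_cong_right) (auto simp: M_def K)
  finally show ?thesis .
qed

lemma gbinomial_minus_one: "(-1::complex) gchoose i = (-1) ^ i"
  using gbinomial_minus[of "1::complex" i] by (simp flip: binomial_gbinomial)

lemma gbinomial_minus_two: "(-2::complex) gchoose i = (-1) ^ i * (of_nat i + 1)"
proof -
  have "(1 + of_nat i :: complex) gchoose i = of_nat (Suc i choose i)"
    using binomial_gbinomial[of "Suc i" i, where 'a=complex] by (simp del: binomial_Suc_n)
  then show ?thesis using gbinomial_minus[of "2::complex" i] by simp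
qed

text \<open>The Borcherds identity for c = \<open>vac\<close>, m = -1, k = 0: by the creation
  property only i = 0 survives on the right, and it equals -(-1)^n b_n a.\<close>

lemma skew_symmetry:
  assumes K: "\<And>i. i \<ge> K \<Longrightarrow> Y a (n + int i) b = 0"
  shows "Y b n a = - smul ((-1) powi n) (\<Sum>i<K. smul ((-1) ^ i) (Y (Y a (n + int i) b) (-1 - int i) vac))"
proof -
  obtain N where N: "\<And>M. M \<ge> N \<Longrightarrow>
      (\<Sum>i<M. smul (of_int (-1) gchoose i) (Y (Y a (n + int i) b) (-1 + 0 - int i) vac)) =
      (\<Sum>i<M. smul ((-1) ^ i * (of_int n gchoose i))
         (Y a (-1 + n - int i) (Y b (0 + int i) vac)
          - smul ((-1) powi n) (Y b (n + 0 - int i) (Y a (-1 + int i) vac))))"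
    using borcherds[of a b vac "-1" n 0] by auto
  define M where "M = max (max N K) 1"
  have "(\<Sum>i<K. smul ((-1) ^ i) (Y (Y a (n + int i) b) (-1 - int i) vac))
      = (\<Sum>i<M. smul (of_int (-1) gchoose i) (Y (Y a (n + int i) b) (-1 + 0 - int i) vac))"
    by (rule sum.mono_neutral_cong_left) (auto simp: M_def K gbinomial_minus_one)
  also have "\<dots> = (\<Sum>i<M. smul ((-1) ^ i * (of_int n gchoose i))
         (Y a (-1 + n - int i) (Y b (0 + int i) vac)
          - smul ((-1) powi n) (Y b (n + 0 - int i) (Y a (-1 + int i) vac))))"
    by (rule N) (simp add: M_def)
  also have "\<dots> = (\<Sum>i\<in>{0}. smul ((-1) ^ i * (of_int n gchoose i))
         (Y a (-1 + n - int i) (Y b (0 + int i) vac)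
          - smul ((-1) powi n) (Y b (n + 0 - int i) (Y a (-1 + int i) vac))))"
    by (rule sum.mono_neutral_right) (auto simp: M_def)
  also have "\<dots> = - smul ((-1) powi n) (Y b n a)" by simp
  finally show ?thesis
    by (simp add: power_int_mult_distrib[symmetric] scale_minus_right)
qed

text \<open>With T u = u_(-2) vac this is Y(T u, z) = d/dz Y(u, z), obtained from the iterate
  formula with \<open>vac\<close> as second vector.\<close>

lemma translation_mode: "Y (Y u (-2) vac) n v = smul (- of_int n) (Y u (n - 1) v)"
proof -
  obtain N where N: "\<And>n. n \<ge> N \<Longrightarrow> Y u n v = 0" using truncation[of u v] by auto
  define K where "K = nat (\<bar>N\<bar> + \<bar>n\<bar> + 1)"
  have "Y (Y u (-2) vac) n v = (\<Sum>i<K. smul ((-1) ^ i * (of_int (-2) gchoose i))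
    (Y u (-2 - int i) (Y vac (n + int i) v)
      - smul ((-1) powi (-2)) (Y vac (-2 + n - int i) (Y u (int i) v))))"
    by (rule mode_iterate) (auto simp: K_def N Y_vac_left)
  \<comment> \<open>A mode of \<open>vac\<close> is nonzero only at index -1, so at most i = -1 - n
    (for n < 0) or i = n - 1 (for n > 0) contributes; \<open>K\<close> was chosen large enough to
    include either.\<close>
  also have "\<dots> = (\<Sum>i<K. smul (of_nat i + 1)
      ((if n + int i = -1 then Y u (n - 1) v else 0) - (if int i = n - 1 then Y u (n - 1) v else 0)))"
  proof (rule sum.cong[OF refl])
    fix i
    have "Y u (-2 - int i) v = Y u (n - 1) v" if "n + int i = -1"
      by (rule arg_cong2[where f = "\<lambda>k. Y u k"]) (use that in auto)
    moreover have "(-2 + n - int i = -1) = (int i = n - 1)" by linarith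
    ultimately show "smul ((-1) ^ i * (of_int (-2) gchoose i))
      (Y u (-2 - int i) (Y vac (n + int i) v)
        - smul ((-1) powi (-2)) (Y vac (-2 + n - int i) (Y u (int i) v)))
      = smul (of_nat i + 1)
      ((if n + int i = -1 then Y u (n - 1) v else 0) - (if int i = n - 1 then Y u (n - 1) v else 0))"
      by (auto simp: Y_vac_left gbinomial_minus_two)
  qed
  also have "\<dots> = smul (- of_int n) (Y u (n - 1) v)"
  proof -
    consider "n < 0" | "n = 0" | "n > 0" by linarith
    then show ?thesis
    proof cases
      case 1
      define j where "j = nat (-1 - n)"
      have "(\<Sum>i<K. smul (of_nat i + 1)
        ((if n + int i = -1 then Y u (n - 1) v else 0) - (if int i = n - 1 then Y u (n - 1) v else 0)))
        = (\<Sum>i\<in>{j}. smul (of_nat i + 1) (Y u (n - 1) v))"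
        using 1 by (intro sum.mono_neutral_cong_right) (auto simp: j_def K_def)
      moreover have "of_nat j + 1 = (- of_int n :: complex)"
        using 1 by (simp add: j_def)
      ultimately show ?thesis by simp
    next
      case 2
      then show ?thesis by (auto intro!: sum.neutral)
    next
      case 3
      define j where "j = nat (n - 1)"
      have "(\<Sum>i<K. smul (of_nat i + 1)
        ((if n + int i = -1 then Y u (n - 1) v else 0) - (if int i = n - 1 then Y u (n - 1) v else 0)))
        = (\<Sum>i\<in>{j}. smul (of_nat i + 1) (- Y u (n - 1) v))"
        using 3 by (intro sum.mono_neutral_cong_right) (auto simp: j_def K_def)
      moreover have "of_nat j + 1 = (of_int n :: complex)"
        using 3 by (simp add: j_def)
      ultimately show ?thesis by simp
    qed
  qed
  finally show ?thesis .
qed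

text \<open>This is [T, a_m] = -m a_(m-1) for T v = v_(-2) vac. The iterate formula on
  \<open>vac\<close> stops after two terms by the creation property.\<close>

lemma translation_derivation:
  "Y (Y a m v) (-2) vac = Y a m (Y v (-2) vac) - smul (of_int m) (Y a (m - 1) v)"
proof -
  have "Y (Y a m v) (-2) vac = (\<Sum>i<2. smul ((-1) ^ i * (of_int m gchoose i))
    (Y a (m - int i) (Y v (-2 + int i) vac)
      - smul ((-1) powi m) (Y v (m + -2 - int i) (Y a (int i) vac))))"
    by (rule mode_iterate) auto
  then show ?thesis
    by (simp add: numeral_2_eq_2)
qed

end

section \<open>Vertex algebras graded by L(0) with one-dimensional weight zero space\<close>

locale graded_vertex_algebra = full_vertex_algebra smul Y vac
  for smul :: "complex \<Rightarrow> 'v::ab_group_add \<Rightarrow> 'v" and Y :: "'v \<Rightarrow> int \<Rightarrow> 'v \<Rightarrow> 'v" and vac +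
  fixes \<omega> :: 'v
  assumes omega_0: "Y \<omega> 0 v = Y v (-2) vac"
    and omega_1_omega: "Y \<omega> 1 \<omega> = smul 2 \<omega>"
    and weight_neg: "n < 0 \<Longrightarrow> Y \<omega> 1 v = smul (of_int n) v \<Longrightarrow> v = 0"
    and weight_zero: "Y \<omega> 1 v = 0 \<Longrightarrow> \<exists>c. v = smul c vac"
    and weight_finite: "\<exists>B. finite B \<and> {v. Y \<omega> 1 v = smul (of_int n) v} \<subseteq> span B"
begin

text \<open>[L(0), u_n] = (L(-1) u)_(n+1) + (L(0) u)_n, and the two terms contribute -(n+1) and 2.
  Thus u_n raises the weight by 1 - n.\<close>

lemma weight_mode:
  assumes "Y \<omega> 1 u = smul 2 u"
  shows "Y \<omega> 1 (Y u n v) = Y u n (Y \<omega> 1 v) + smul (1 - of_int n) (Y u n v)"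
proof -
  have "Y \<omega> 1 (Y u n v) - Y u n (Y \<omega> 1 v) = Y (Y \<omega> 0 u) (1 + n) v + Y (smul 2 u) n v"
    using mode_commutator_nat[of \<omega> 1 u n v] by (simp add: assms)
  also have "\<dots> = smul (- of_int (1 + n)) (Y u n v) + smul 2 (Y u n v)"
    by (simp only: omega_0 translation_mode Y_scale_left) simp
  also have "\<dots> = smul (1 - of_int n) (Y u n v)"
    by (simp flip: scale_left_distrib)
  finally show ?thesis by (simp add: algebra_simps)
qed

lemma weight_mode_eigenvector:
  assumes "Y \<omega> 1 u = smul 2 u" and "Y \<omega> 1 v = smul (of_int k) v"
  shows "Y \<omega> 1 (Y u n v) = smul (of_int (k + 1 - n)) (Y u n v)"
proof -
  have "Y \<omega> 1 (Y u n v) = smul (of_int k + (1 - of_int n)) (Y u n v)"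
    using weight_mode[OF assms(1), of n v] by (simp only: assms(2) Y_scale_right scale_left_distrib)
  then show ?thesis by (simp add: add_diff_eq)
qed

end

section \<open>The vertex operator subalgebra generated by a candidate vector\<close>

locale semi_conformal_candidate = graded_vertex_algebra smul Y vac \<omega>
  for smul :: "complex \<Rightarrow> 'v::ab_group_add \<Rightarrow> 'v" and Y :: "'v \<Rightarrow> int \<Rightarrow> 'v \<Rightarrow> 'v" and vac \<omega> +
  fixes u :: 'v
  assumes omega_1_u: "Y \<omega> 1 u = smul 2 u"
    and omega_2_u: "Y \<omega> 2 u = 0"
    and u_1_u: "Y u 1 u = smul 2 u"
begin

text \<open>The product has weight 3 - i, which is negative.\<close>

lemma omega_high_u: "i \<ge> 4 \<Longrightarrow> Y \<omega> i u = 0"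
  using weight_mode_eigenvector[OF omega_1_omega, of u 2 i]
  by (intro weight_neg[of "3 - i"]) (simp_all add: omega_1_u)

lemma u_high_u: "i \<ge> 4 \<Longrightarrow> Y u i u = 0"
  using weight_mode_eigenvector[OF omega_1_u, of u 2 i]
  by (intro weight_neg[of "3 - i"]) (simp_all add: omega_1_u)

text \<open>Half the central charge of \<open>u\<close>; such a scalar exists because u_3 u has
  weight 0.\<close>

definition half_charge where "half_charge = (SOME c. Y u 3 u = smul c vac)"

lemma u_3_u: "Y u 3 u = smul half_charge vac"
  unfolding half_charge_def
  by (rule someI_ex, rule weight_zero) (use weight_mode_eigenvector[OF omega_1_u, of u 2 3] in \<open>simp add: omega_1_u\<close>)

text \<open>Skew symmetry gives u_2 u = -u_2 u + T(u_3 u), and T kills the multiple u_3 u of the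
  vacuum.\<close>

lemma u_2_u: "Y u 2 u = 0"
proof -
  have "Y u 2 u = - smul ((-1) powi 2)
      (\<Sum>i<2. smul ((-1) ^ i) (Y (Y u (2 + int i) u) (-1 - int i) vac))"
    by (rule skew_symmetry) (auto simp: u_high_u)
  then have "Y u 2 u = - Y u 2 u"
    by (simp add: numeral_2_eq_2 u_3_u Y_scale_left Y_vac_left)
  then show ?thesis
    using double_eq_scale[of "Y u 2 u"] by (simp add: eq_neg_iff_add_eq_0)
qed

text \<open>Skew symmetry gives u_0 u = -u_0 u + T(u_1 u), the terms from u_2 u and u_3 u being
  zero, and u_1 u = 2 u.\<close>

lemma u_0_u: "Y u 0 u = Y u (-2) vac"
proof (rule scale_two_cancel)
  have "Y u 0 u = - smul ((-1) powi 0)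
      (\<Sum>i<4. smul ((-1) ^ i) (Y (Y u (0 + int i) u) (-1 - int i) vac))"
    by (rule skew_symmetry) (auto simp: u_high_u)
  then have "Y u 0 u = - Y u 0 u + smul 2 (Y u (-2) vac)"
    by (simp add: eval_nat_numeral u_3_u u_2_u u_1_u Y_scale_left Y_vac_left)
  then show "smul 2 (Y u 0 u) = smul 2 (Y u (-2) vac)"
    unfolding double_eq_scale[symmetric] by (simp add: algebra_simps)
qed

text \<open>Compare both sides of \<open>\<omega>\<^sub>3 (u\<^sub>1 u) = 2 \<omega>\<^sub>3 u\<close> by commuting \<open>\<omega>\<^sub>3\<close> past \<open>u\<^sub>1\<close>.\<close>

lemma omega_3_u: "Y \<omega> 3 u = smul half_charge vac"
proof (rule scale_two_cancel)
  have "Y \<omega> 1 (Y \<omega> 3 u) = 0"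
    using weight_mode[OF omega_1_omega, of 3 u] by (simp add: omega_1_u Y_scale_right flip: scale_left_distrib)
  then obtain c where c: "Y \<omega> 3 u = smul c vac" using weight_zero by blast
  have "Y \<omega> (int 3) (Y u 1 u) - Y u 1 (Y \<omega> (int 3) u) =
    (\<Sum>i\<le>3. smul (of_nat (3 choose i)) (Y (Y \<omega> (int i) u) (int 3 + 1 - int i) u))"
    by (rule mode_commutator_nat)
  moreover have "{..3::nat} = {0,1,2,3}" by auto
  ultimately have "smul 2 (Y \<omega> 3 u) = Y (Y \<omega> 0 u) 4 u + smul 3 (Y (smul 2 u) 3 u)"
    by (simp add: c Y_scale_left Y_scale_right Y_vac_left omega_2_u omega_1_u u_1_u)
  also have "\<dots> = smul 2 (Y u 3 u)"
    by (simp add: omega_0 translation_mode Y_scale_left flip: scale_left_distrib scale_left_diff_distrib)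
  finally show "smul 2 (Y \<omega> 3 u) = smul 2 (smul half_charge vac)" by (simp add: u_3_u)
qed

text \<open>The heart of the sufficiency proof: nonnegative modes of \<omega> and of
  \<open>u\<close> have commutators with u_k determined by these products alone.\<close>

lemma omega_u_nonneg: "n \<ge> 0 \<Longrightarrow> Y \<omega> n u = Y u n u"
proof -
  assume "n \<ge> 0"
  then consider "n = 0" | "n = 1" | "n = 2" | "n = 3" | "n \<ge> 4" by linarith
  then show ?thesis
    by cases (simp_all add: omega_0 u_0_u omega_1_u u_1_u omega_2_u u_2_u omega_3_u u_3_u
      omega_high_u u_high_u)
qed

definition u_word :: "int list \<Rightarrow> 'v" where "u_word ns = foldr (Y u) ns vac"

lemma u_word_simps [simp]: "u_word [] = vac" "u_word (n # ns) = Y u n (u_word ns)"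
  by (simp_all add: u_word_def)

definition U where "U = span (range u_word)"

lemma U_subspace: "subspace U"
  unfolding U_def by (rule subspace_span)

lemma U_induct [consumes 1, case_names word add scale]:
  assumes "v \<in> U" and "\<And>ns. P (u_word ns)" and "\<And>x y. P x \<Longrightarrow> P y \<Longrightarrow> P (x + y)"
    and "\<And>c x. P x \<Longrightarrow> P (smul c x)"
  shows "P v"
proof -
  have "P 0" using assms(4)[OF assms(2), of 0] by simp
  then have "subspace {x. P x}" using assms by (auto intro!: subspaceI)
  with assms(1) show ?thesis unfolding U_def by (rule span_induct) (use assms(2) in auto)
qed

lemma u_word_U: "u_word ns \<in> U"
  unfolding U_def by (rule span_base) simp

lemma U_u_mode: "v \<in> U \<Longrightarrow> Y u n v \<in> U"
proof (induction rule: U_induct)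
  case (word ns)
  show ?case using u_word_U[of "n # ns"] by simp
qed (simp_all add: Y_add_right Y_scale_right subspace_add[OF U_subspace] subspace_scale[OF U_subspace])

text \<open>The iterate formula expresses a mode of u_k w through modes of \<open>u\<close> and
  modes of the shorter word w. Hence the span of words in the modes of \<open>u\<close> is closed
  under all modes of its elements.\<close>

lemma U_word_mode: "v \<in> U \<Longrightarrow> Y (u_word ns) n v \<in> U"
proof (induction ns arbitrary: n v)
  case Nil
  then show ?case by (simp add: Y_vac_left subspace_0[OF U_subspace])
next
  case (Cons k ns)
  obtain N1 where N1: "\<And>n. n \<ge> N1 \<Longrightarrow> Y (u_word ns) n v = 0"
    using truncation[of "u_word ns" v] by auto
  obtain N2 where N2: "\<And>n. n \<ge> N2 \<Longrightarrow> Y u n v = 0" using truncation[of u v] by auto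
  define K where "K = nat (max (N1 - n) N2)"
  have "Y (Y u k (u_word ns)) n v = (\<Sum>i<K. smul ((-1) ^ i * (of_int k gchoose i))
    (Y u (k - int i) (Y (u_word ns) (n + int i) v)
      - smul ((-1) powi k) (Y (u_word ns) (k + n - int i) (Y u (int i) v))))"
    by (rule mode_iterate) (auto simp: K_def N1 N2)
  moreover have "\<dots> \<in> U"
    by (intro subspace_sum[OF U_subspace] subspace_scale[OF U_subspace] subspace_diff[OF U_subspace]
        U_u_mode Cons)
  ultimately show ?case by simp
qed

lemma U_mode: "x \<in> U \<Longrightarrow> v \<in> U \<Longrightarrow> Y x n v \<in> U"
  by (induction x rule: U_induct)
    (simp_all add: U_word_mode Y_add_left Y_scale_left subspace_add[OF U_subspace] subspace_scale[OF U_subspace])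

lemma u_U: "u \<in> U" using u_word_U[of "[-1]"] by simp

lemma vac_U: "vac \<in> U" using u_word_U[of "[]"] by simp

text \<open>Induction on words: both modes kill the vacuum and have the same commutator with every
  u_k.\<close>

lemma omega_eq_u_on_U: "v \<in> U \<Longrightarrow> Y \<omega> (int n) v = Y u (int n) v"
proof (induction v rule: U_induct)
  case (word ns)
  show ?case
  proof (induction ns)
    case (Cons k ns)
    have "Y \<omega> (int n) (Y u k (u_word ns)) - Y u k (Y \<omega> (int n) (u_word ns))
        = Y u (int n) (Y u k (u_word ns)) - Y u k (Y u (int n) (u_word ns))"
      unfolding mode_commutator_nat by (simp add: omega_u_nonneg)
    then show ?case by (simp add: Cons)
  qed simp
qed (simp_all add: Y_add_right Y_scale_right)

text \<open>Only u_0 u, u_1 u and u_3 u enter the commutator formula. The last comes with binomial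
  (m+1 choose 3) = (m^3 - m)/6, so the central charge is \<open>2 * half_charge\<close>.\<close>

lemma u_virasoro:
  "Y u (m + 1) (Y u (n + 1) v) - Y u (n + 1) (Y u (m + 1) v) =
    smul (of_int (m - n)) (Y u (m + n + 1) v)
    + smul (if m + n = 0 then of_int (m ^ 3 - m) / 12 * (2 * half_charge) else 0) v"
proof -
  have 3: "(of_int (1 + m) :: complex) gchoose 3 = of_int (m ^ 3 - m) / 6"
    by (simp add: gbinomial_prod_rev eval_nat_numeral algebra_simps)
  have "Y u (m + 1) (Y u (n + 1) v) - Y u (n + 1) (Y u (m + 1) v) =
      (\<Sum>i<4. smul (of_int (m + 1) gchoose i) (Y (Y u (int i) u) (m + 1 + (n + 1) - int i) v))"
    by (rule mode_commutator) (auto simp: u_high_u)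
  moreover have "{..<4::nat} = {0,1,2,3}" by auto
  ultimately have "Y u (m + 1) (Y u (n + 1) v) - Y u (n + 1) (Y u (m + 1) v) =
      Y (Y u (-2) vac) (m + n + 2) v + smul (of_int (m + 1) * 2) (Y u (m + n + 1) v)
      + smul (of_int (m ^ 3 - m) / 6 * half_charge) (Y vac (m + n - 1) v)"
    by (simp add: 3 u_0_u u_1_u u_2_u u_3_u Y_scale_left algebra_simps del: of_int_add)
  also have "Y (Y u (-2) vac) (m + n + 2) v = smul (- of_int (m + n + 2)) (Y u (m + n + 1) v)"
    by (simp add: translation_mode algebra_simps)
  also have "smul (- of_int (m + n + 2)) (Y u (m + n + 1) v) + smul (of_int (m + 1) * 2) (Y u (m + n + 1) v)
      = smul (of_int (m - n)) (Y u (m + n + 1) v)"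
    by (simp flip: scale_left_distrib)
  finally show ?thesis by (simp add: Y_vac_left)
qed

lemma u_word_weight: "Y \<omega> 1 (u_word ns) = smul (of_int (\<Sum>n\<leftarrow>ns. 1 - n)) (u_word ns)"
proof (induction ns)
  case (Cons n ns)
  have "(\<Sum>n\<leftarrow>n # ns. 1 - n) = (\<Sum>n\<leftarrow>ns. 1 - n) + 1 - n" by simp
  then show ?case
    by (simp only: u_word_simps weight_mode_eigenvector[OF omega_1_u Cons.IH])
qed simp

lemma subalgebra_U: "vertex_subalgebra smul UNIV Y vac U"
  by (simp add: vertex_subalgebra_def U_subspace vac_U U_mode)

lemma vertex_algebra_U: "vertex_algebra smul U Y vac"
  by unfold_locales
    (auto simp: U_subspace vac_U U_mode Y_add_left Y_add_right Y_scale_left Y_scale_right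
      Y_vac_left intro: truncation[simplified] borcherds[simplified])

lemma vertex_operator_algebra_U: "vertex_operator_algebra smul U Y vac u"
proof -
  interpret U: vertex_algebra smul U Y vac by (rule vertex_algebra_U)
  \<comment> \<open>The subalgebra inherits its grading: the weight spaces for \<open>u\<close> are
    those for \<omega> intersected with \<open>U\<close>, so finiteness and boundedness carry
    over.\<close>
  have eigen: "{v \<in> U. Y u 1 v = smul (of_int n) v} = {v \<in> U. Y \<omega> 1 v = smul (of_int n) v}" for n
    using omega_eq_u_on_U[of _ 1] by auto
  show ?thesis
  proof
    show "u \<in> U" by (rule u_U)
    show "\<exists>c. \<forall>m n. \<forall>v\<in>U. Y u (m + 1) (Y u (n + 1) v) - Y u (n + 1) (Y u (m + 1) v) =
      smul (of_int (m - n)) (Y u (m + n + 1) v)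
      + smul (if m + n = 0 then of_int (m ^ 3 - m) / 12 * c else 0) v"
      using u_virasoro by blast
    show "Y (Y u 0 x) n v = smul (- of_int n) (Y x (n - 1) v)" if "x \<in> U" "v \<in> U" for x v n
    proof -
      have "Y u 0 x = Y x (-2) vac" using omega_eq_u_on_U[OF that(1), of 0] by (simp add: omega_0)
      then show ?thesis by (simp add: translation_mode)
    qed
    show "U = span (\<Union>n::int. {v \<in> U. Y u 1 v = smul (of_int n) v})"
    proof
      show "U \<subseteq> span (\<Union>n::int. {v \<in> U. Y u 1 v = smul (of_int n) v})"
        unfolding eigen by (subst (1) U_def, rule span_mono) (use u_word_U u_word_weight in blast)
      show "span (\<Union>n::int. {v \<in> U. Y u 1 v = smul (of_int n) v}) \<subseteq> U"
        by (rule span_minimal) (auto simp: U_subspace)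
    qed
    show "\<exists>B. finite B \<and> {v \<in> U. Y u 1 v = smul (of_int n) v} \<subseteq> span B" for n
      unfolding eigen using weight_finite[of n] by blast
    show "\<exists>N::int. \<forall>n<N. {v \<in> U. Y u 1 v = smul (of_int n) v} = {0}"
      unfolding eigen using weight_neg subspace_0[OF U_subspace] by (intro exI[of _ 0]) auto
  qed
qed

lemma u_semi_conformal: "u \<in> Sc smul UNIV Y vac \<omega>"
  unfolding Sc_def using subalgebra_U vertex_operator_algebra_U omega_eq_u_on_U
  by (auto intro!: exI[of _ U]) (metis nonneg_int_cases)

end

section \<open>Three equations characterizing semi-conformal vectors\<close>

context graded_vertex_algebra
begin

lemma semi_conformal_iff:
  "u \<in> Sc smul UNIV Y vac \<omega> \<longleftrightarrow> Y \<omega> 1 u = smul 2 u \<and> Y \<omega> 2 u = 0 \<and> Y u 1 u = smul 2 u"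
proof
  assume "u \<in> Sc smul UNIV Y vac \<omega>"
  then obtain U where voa: "vertex_operator_algebra smul U Y vac u"
    and eq: "\<And>n v. n \<ge> 0 \<Longrightarrow> v \<in> U \<Longrightarrow> Y u n v = Y \<omega> n v"
    unfolding Sc_def by blast
  interpret U: vertex_operator_algebra smul U Y vac u by (rule voa)
  obtain c where vir: "\<And>m n v. v \<in> U \<Longrightarrow>
      Y u (m + 1) (Y u (n + 1) v) - Y u (n + 1) (Y u (m + 1) v) =
      smul (of_int (m - n)) (Y u (m + n + 1) v)
      + smul (if m + n = 0 then of_int (m ^ 3 - m) / 12 * c else 0) v"
    using U.virasoro by blast
  \<comment> \<open>Since u_(-1) vac = u, the Virasoro relations for [L(0), L(-2)] and [L(1), L(-2)]
    on the vacuum give L(0) u = 2 u and L(1) u = 0.\<close>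
  have "Y u 1 u = smul 2 u" using vir[OF U.vac_closed, of 0 "-2"] by simp
  moreover have "Y u 2 u = 0" using vir[OF U.vac_closed, of 1 "-2"] by simp
  ultimately show "Y \<omega> 1 u = smul 2 u \<and> Y \<omega> 2 u = 0 \<and> Y u 1 u = smul 2 u"
    using eq[OF _ U.conformal_closed, of 1] eq[OF _ U.conformal_closed, of 2] by simp
next
  assume "Y \<omega> 1 u = smul 2 u \<and> Y \<omega> 2 u = 0 \<and> Y u 1 u = smul 2 u"
  then interpret semi_conformal_candidate smul Y vac \<omega> u by unfold_locales auto
  show "u \<in> Sc smul UNIV Y vac \<omega>" by (rule u_semi_conformal)
qed

end

section \<open>The matrix equation\<close>

text \<open>The proof method \<open>algebra\<close> only uses premises of the form \<open>p = 0\<close>.\<close>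

lemma diff_zeroI: "a = b \<Longrightarrow> a - b = 0" for a b :: complex
  by simp

section \<open>Cayley-Hamilton and symmetric idempotents of trace 1\<close>

lemma cayley_hamilton_3:
  fixes A :: "complex ^ 3 ^ 3"
  shows "(A ** A ** A)$i$j = trace A * (A ** A)$i$j - (trace A ^ 2 - trace (A ** A)) / 2 * A$i$j
    + (if i = j then det A else 0)"
  using exhaust_3[of i] exhaust_3[of j]
  by (elim disjE; simp add: matrix_matrix_mult_def sum_3 trace_def det_3 field_simps power2_eq_square)

lemma symmetric_entry:
  assumes "transpose P = P"
  shows "P$i$j = P$j$i"
proof -
  have "transpose P$i$j = P$j$i" by (simp add: transpose_def)
  then show ?thesis by (simp add: assms)
qed

text \<open>An idempotent of trace 1 has rank 1, so all its 2 x 2 minors vanish. Each minor is a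
  polynomial consequence of the entries of P^2 = P once P_33 is eliminated by the trace.\<close>

lemma adjugate_minor_3:
  fixes P :: "complex ^ 3 ^ 3"
  assumes "transpose P = P" "P ** P = P" "trace P = 1"
  shows "P$i$j * P$k$m = P$i$m * P$k$j"
proof -
  have s: "P$2$1 = P$1$2" "P$3$1 = P$1$3" "P$3$2 = P$2$3"
    using symmetric_entry[OF assms(1)] by blast+
  have i: "(P ** P)$i$j = P$i$j" for i j by (simp add: assms(2))
  have e: "P$1$1 * P$1$1 + P$1$2 * P$1$2 + P$1$3 * P$1$3 = P$1$1"
    "P$1$2 * P$1$2 + P$2$2 * P$2$2 + P$2$3 * P$2$3 = P$2$2"
    "P$1$3 * P$1$3 + P$2$3 * P$2$3 + P$3$3 * P$3$3 = P$3$3"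
    "P$1$1 * P$1$2 + P$1$2 * P$2$2 + P$1$3 * P$2$3 = P$1$2"
    "P$1$1 * P$1$3 + P$1$2 * P$2$3 + P$1$3 * P$3$3 = P$1$3"
    "P$1$2 * P$1$3 + P$2$2 * P$2$3 + P$2$3 * P$3$3 = P$2$3"
    using i[of 1 1] i[of 2 2] i[of 3 3] i[of 1 2] i[of 1 3] i[of 2 3]
    by (simp_all add: matrix_matrix_mult_def sum_3 s)
  have t: "P$3$3 = 1 - P$1$1 - P$2$2" using assms(3) by (simp add: trace_def sum_3 algebra_simps)
  have "P$1$1 * P$2$2 = P$1$2 * P$1$2" using e(1-3)[THEN diff_zeroI] unfolding t by algebra
  moreover have "P$1$1 * P$3$3 = P$1$3 * P$1$3" using e(1-3)[THEN diff_zeroI] unfolding t by algebra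
  moreover have "P$2$2 * P$3$3 = P$2$3 * P$2$3" using e(1-3)[THEN diff_zeroI] unfolding t by algebra
  moreover have "P$3$3 * P$1$2 = P$1$3 * P$2$3" using e(4)[THEN diff_zeroI] unfolding t by algebra
  moreover have "P$2$2 * P$1$3 = P$1$2 * P$2$3" using e(5)[THEN diff_zeroI] unfolding t by algebra
  moreover have "P$1$1 * P$2$3 = P$1$2 * P$1$3" using e(6)[THEN diff_zeroI] unfolding t by algebra
  ultimately show ?thesis
    using exhaust_3[of i] exhaust_3[of j] exhaust_3[of k] exhaust_3[of m]
    by (elim disjE; simp add: s ac_simps)
qed

lemma rank_one_projection:
  fixes P :: "complex ^ 3 ^ 3"
  assumes "transpose P = P" "P ** P = P" "trace P = 1"
  obtains v :: "complex ^ 3" where "(\<Sum>i\<in>UNIV. v$i * v$i) = 1" "\<And>i j. P$i$j = v$i * v$j"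
proof -
  obtain k where k: "P$k$k \<noteq> 0"
    using assms(3) sum.neutral[of UNIV "\<lambda>k. P$k$k"] unfolding trace_def by force
  \<comment> \<open>A row through a nonzero diagonal entry, scaled so that v_k^2 = P_kk; vanishing
    of the minors then gives P = v v^T.\<close>
  define v :: "complex ^ 3" where "v = (\<chi> j. P$k$j / csqrt (P$k$k))"
  have vv: "v$i * v$j = P$i$j" for i j
  proof -
    have "v$i * v$j = P$k$i * P$k$j / (csqrt (P$k$k))\<^sup>2"
      by (simp add: v_def power2_eq_square)
    also have "P$k$i = P$i$k" by (rule symmetric_entry[OF assms(1)])
    also have "P$i$k * P$k$j = P$i$j * P$k$k" by (rule adjugate_minor_3[OF assms])
    finally show ?thesis using k by simp
  qed
  show ?thesis
    by (rule that[of v]) (use assms(3) in \<open>simp_all add: vv trace_def\<close>)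
qed

text \<open>Over the complex numbers a nonzero vector may be isotropic and cannot be normalized. A
  non-isotropic vector orthogonal to \<open>v\<close> must therefore be found first; the cross
  product completes the basis.\<close>

lemma SO3_first_column:
  fixes v :: "complex ^ 3"
  assumes "(\<Sum>i\<in>UNIV. v$i * v$i) = 1"
  obtains Q where "Q \<in> SO3" "\<And>i. Q$i$1 = v$i"
proof -
  have v: "v$1 * v$1 + v$2 * v$2 + v$3 * v$3 = 1" using assms by (simp add: sum_3)
  obtain u :: "complex ^ 3" where u: "u$1 * v$1 + u$2 * v$2 + u$3 * v$3 = 0"
    and nz: "u$1 * u$1 + u$2 * u$2 + u$3 * u$3 \<noteq> 0"
  proof -
    \<comment> \<open>These are the squares of the cross products of \<open>v\<close> with the
      coordinate vectors, up to sign. They add up to 2, so one of them is nonzero.\<close>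
    consider "v$2 * v$2 + v$3 * v$3 \<noteq> 0" | "v$1 * v$1 + v$3 * v$3 \<noteq> 0" | "v$1 * v$1 + v$2 * v$2 \<noteq> 0"
    proof (rule ccontr)
      assume "\<not> thesis"
      with that have "v$2 * v$2 + v$3 * v$3 = 0" "v$1 * v$1 + v$3 * v$3 = 0" "v$1 * v$1 + v$2 * v$2 = 0"
        by blast+
      then have "2 * (v$1 * v$1 + v$2 * v$2 + v$3 * v$3) = 0" by algebra
      with v show False by simp
    qed
    then show ?thesis
    proof cases
      case 1 then show ?thesis by (intro that[of "vector [0, v$3, - v$2]"]) (simp_all add: add.commute)
    next
      case 2 then show ?thesis by (intro that[of "vector [v$3, 0, - v$1]"]) (simp_all add: add.commute)
    next
      case 3 then show ?thesis by (intro that[of "vector [v$2, - v$1, 0]"]) (simp_all add: add.commute)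
    qed
  qed
  define s where "s = csqrt (u$1 * u$1 + u$2 * u$2 + u$3 * u$3)"
  have s2: "s * s = u$1 * u$1 + u$2 * u$2 + u$3 * u$3"
    unfolding s_def by (simp flip: power2_eq_square)
  have s0: "s \<noteq> 0" using s2 nz by auto
  define a b c where "a = u$1 / s" and "b = u$2 / s" and "c = u$3 / s"
  have w1: "a * a + b * b + c * c = 1"
  proof -
    have "a * a + b * b + c * c = (u$1 * u$1 + u$2 * u$2 + u$3 * u$3) / (s * s)"
      by (simp add: a_def b_def c_def add_divide_distrib)
    then show ?thesis using s2 s0 nz by simp
  qed
  have w2: "a * v$1 + b * v$2 + c * v$3 = 0"
    using u s0 by (simp add: a_def b_def c_def flip: add_divide_distrib)
  \<comment> \<open>The third column is the cross product of the first two; its square, computed by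
    the Lagrange identity, is also the determinant.\<close>
  define Q :: "complex ^ 3 ^ 3" where
    "Q = vector [vector [v$1, a, v$2 * c - v$3 * b], vector [v$2, b, v$3 * a - v$1 * c],
      vector [v$3, c, v$1 * b - v$2 * a]]"
  have lagrange: "(v$2 * c - v$3 * b) * (v$2 * c - v$3 * b) + (v$3 * a - v$1 * c) * (v$3 * a - v$1 * c)
      + (v$1 * b - v$2 * a) * (v$1 * b - v$2 * a) = 1"
  proof -
    have "(v$2 * c - v$3 * b) * (v$2 * c - v$3 * b) + (v$3 * a - v$1 * c) * (v$3 * a - v$1 * c)
      + (v$1 * b - v$2 * a) * (v$1 * b - v$2 * a)
      = (v$1 * v$1 + v$2 * v$2 + v$3 * v$3) * (a * a + b * b + c * c)
        - (a * v$1 + b * v$2 + c * v$3) * (a * v$1 + b * v$2 + c * v$3)"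
      by algebra
    then show ?thesis by (simp add: v w1 w2)
  qed
  have "transpose Q ** Q = mat 1"
    using v w1 w2 lagrange
    by (simp add: vec_eq_iff forall_3 matrix_matrix_mult_def transpose_def mat_def sum_3 Q_def)
      (simp add: algebra_simps)
  moreover have "det Q = (v$2 * c - v$3 * b) * (v$2 * c - v$3 * b) + (v$3 * a - v$1 * c) * (v$3 * a - v$1 * c)
      + (v$1 * b - v$2 * a) * (v$1 * b - v$2 * a)"
    by (simp add: det_3 Q_def algebra_simps)
  then have "det Q = 1" by (simp only: lagrange)
  ultimately have "Q \<in> SO3"
    by (simp add: SO3_def orthogonal_matrix_def matrix_left_right_inverse[of "transpose Q" Q])
  moreover have "Q$i$1 = v$i" for i using exhaust_3[of i] by (auto simp: Q_def)
  ultimately show ?thesis by (rule that)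
qed

section \<open>Orbits of diagonal matrices with a repeated eigenvalue\<close>

definition axial_matrix :: "complex \<Rightarrow> complex \<Rightarrow> complex ^ 3 \<Rightarrow> complex ^ 3 ^ 3" where
  "axial_matrix x y v = (\<chi> i j. (if i = j then y else 0) + (x - y) * (v$i * v$j))"

text \<open>Conjugating diag(x, y, y) = y + (x - y) e_1 e_1^T by \<open>Q\<close> gives y + (x - y)
  q q^T, where q is the first column of \<open>Q\<close>, and every \<open>v\<close> with v^T v = 1
  is such a column.\<close>

lemma diag3_orbit:
  "{B. \<exists>Q\<in>SO3. B = Q ** diag3 x y y ** transpose Q}
    = {axial_matrix x y v |v :: complex ^ 3. (\<Sum>i\<in>UNIV. v$i * v$i) = 1}"
proof -
  have conj: "Q ** diag3 x y y ** transpose Q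
      = (\<chi> i j. (if i = j then y else 0) + (x - y) * (Q$i$1 * Q$j$1))"
    and norm: "(\<Sum>i\<in>UNIV. Q$i$1 * Q$i$1) = 1" if Q: "Q \<in> SO3" for Q
  proof -
    have "(Q ** transpose Q)$i$j = (mat 1 :: complex ^ 3 ^ 3)$i$j" for i j
      using Q by (simp add: SO3_def orthogonal_matrix_def)
    then have o: "Q$i$1 * Q$j$1 + Q$i$2 * Q$j$2 + Q$i$3 * Q$j$3 = (if i = j then 1 else 0)" for i j
      by (simp add: matrix_matrix_mult_def transpose_def mat_def sum_3)
    have "(Q ** diag3 x y y ** transpose Q)$i$j
      = y * (Q$i$1 * Q$j$1 + Q$i$2 * Q$j$2 + Q$i$3 * Q$j$3) + (x - y) * (Q$i$1 * Q$j$1)" for i j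
      by (simp add: matrix_matrix_mult_def transpose_def diag3_def sum_3 algebra_simps)
    then show "Q ** diag3 x y y ** transpose Q
      = (\<chi> i j. (if i = j then y else 0) + (x - y) * (Q$i$1 * Q$j$1))"
      by (simp add: vec_eq_iff o)
    have "(transpose Q ** Q)$1$1 = (mat 1 :: complex ^ 3 ^ 3)$1$1"
      using Q by (simp add: SO3_def orthogonal_matrix_def)
    then show "(\<Sum>i\<in>UNIV. Q$i$1 * Q$i$1) = 1"
      by (simp add: matrix_matrix_mult_def transpose_def mat_def)
  qed
  show ?thesis
  proof (intro equalityI subsetI)
    fix B assume "B \<in> {B. \<exists>Q\<in>SO3. B = Q ** diag3 x y y ** transpose Q}"
    then obtain Q where "Q \<in> SO3" "B = Q ** diag3 x y y ** transpose Q" by blast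
    with conj norm show "B \<in> {axial_matrix x y v |v :: complex ^ 3. (\<Sum>i\<in>UNIV. v$i * v$i) = 1}"
      by (intro CollectI exI[of _ "\<chi> i. Q$i$1"]) (simp add: axial_matrix_def)
  next
    fix B assume "B \<in> {axial_matrix x y v |v :: complex ^ 3. (\<Sum>i\<in>UNIV. v$i * v$i) = 1}"
    then obtain v :: "complex ^ 3" where v: "(\<Sum>i\<in>UNIV. v$i * v$i) = 1"
      and B: "B = axial_matrix x y v" by blast
    obtain Q where Q: "Q \<in> SO3" "\<And>i. Q$i$1 = v$i" using SO3_first_column[OF v] by blast
    then have "B = Q ** diag3 x y y ** transpose Q" by (simp add: B conj axial_matrix_def)
    with Q(1) show "B \<in> {B. \<exists>Q\<in>SO3. B = Q ** diag3 x y y ** transpose Q}" by blast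
  qed
qed

text \<open>The condition \<open>(\<omega>\<^sub>A)\<^sub>1 \<omega>\<^sub>A = 2 \<omega>\<^sub>A\<close> on symmetric \<open>A\<close>, computed in \<open>Q_square\<close> below.\<close>

definition semi_conformal_matrix :: "complex \<Rightarrow> complex ^ 3 ^ 3 \<Rightarrow> bool" where
  "semi_conformal_matrix l A \<longleftrightarrow> transpose A = A \<and> (\<forall>i j. 4 * (l - 4) * (A ** A)$i$j + (16 * trace A - 2) * A$i$j
     = (if i = j then 4 * (trace A ^ 2 - trace (A ** A)) else 0))"

section \<open>Solutions of the matrix equation\<close>

lemma semi_conformal_matrix_scalar:
  assumes "l \<noteq> -2"
  shows "semi_conformal_matrix l (mat x) \<longleftrightarrow> x = 0 \<or> x = 1 / (2 * (l + 2))"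
proof -
  have l: "l + 2 \<noteq> 0" using assms by (auto simp: add_eq_0_iff2)
  have "semi_conformal_matrix l (mat x) \<longleftrightarrow> 4 * (l - 4) * (x * x) + (16 * (3 * x) - 2) * x = 4 * ((3 * x)^2 - 3 * x * x)"
    by (simp add: semi_conformal_matrix_def transpose_def trace_def mat_def matrix_matrix_mult_def forall_3 sum_3 vec_eq_iff)
  also have "\<dots> \<longleftrightarrow> 2 * (x * (2 * (l + 2) * x - 1)) = 0"
    by (subst eq_iff_diff_eq_0) (simp add: algebra_simps power2_eq_square)
  also have "\<dots> \<longleftrightarrow> x = 0 \<or> x * (2 * (l + 2)) = 1"
    by (simp add: mult.commute[of x "2 * (l + 2)"] del: distrib_left_numeral)
  also have "\<dots> \<longleftrightarrow> x = 0 \<or> x = 1 / (2 * (l + 2))"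
    using l by (simp add: eq_divide_eq del: distrib_left_numeral)
  finally show ?thesis .
qed

text \<open>Assumption \<open>y\<close> is the equation at the eigenvalue y, with trace x + 2y and
  trace of the square x^2 + 2y^2. Assumption \<open>x\<close> is the difference of the equations at
  x and y, divided by x - y.\<close>

lemma semi_conformal_matrix_axial:
  fixes v :: "complex ^ 3"
  assumes v: "(\<Sum>i\<in>UNIV. v$i * v$i) = 1"
    and x: "4 * (l - 4) * (x + y) + 16 * (x + 2 * y) = 2"
    and y: "4 * (l - 4) * (y * y) + (16 * (x + 2 * y) - 2) * y = 4 * (4 * x * y + 2 * y * y)"
  shows "semi_conformal_matrix l (axial_matrix x y v)"
proof -
  define A where "A = axial_matrix x y v"
  have A: "A$i$j = (if i = j then y else 0) + (x - y) * (v$i * v$j)" for i j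
    by (simp add: A_def axial_matrix_def)
  have v': "v$1 * v$1 + v$2 * v$2 + v$3 * v$3 = 1" using v by (simp add: sum_3)
  have A2: "(A ** A)$i$j = (if i = j then y * y else 0) + (x * x - y * y) * (v$i * v$j)" for i j
  proof -
    have "(A ** A)$i$j = (\<Sum>k\<in>UNIV. (if i = k then y * A$k$j else 0) + (x - y) * v$i * (v$k * A$k$j))"
      by (simp only: matrix_matrix_mult_def vec_lambda_beta, rule sum.cong) (auto simp: A[of i] algebra_simps)
    also have "\<dots> = y * A$i$j + (x - y) * v$i * (\<Sum>k\<in>UNIV. v$k * A$k$j)"
      by (simp add: sum.distrib sum_distrib_left)
    also have "(\<Sum>k\<in>UNIV. v$k * A$k$j) = (\<Sum>k\<in>UNIV. (if k = j then y * v$k else 0) + (x - y) * v$j * (v$k * v$k))"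
      by (rule sum.cong) (simp_all add: A algebra_simps)
    also have "\<dots> = y * v$j + (x - y) * v$j * (\<Sum>k\<in>UNIV. v$k * v$k)"
      by (simp add: sum.distrib sum_distrib_left)
    finally show ?thesis by (simp add: v A algebra_simps)
  qed
  have tr: "trace A = x + 2 * y"
  proof -
    have "trace A = 3 * y + (x - y) * (v$1 * v$1 + v$2 * v$2 + v$3 * v$3)"
      by (simp add: trace_def sum_3 A algebra_simps)
    then show ?thesis by (simp add: v')
  qed
  have tr2: "trace (A ** A) = x * x + 2 * (y * y)"
  proof -
    have "trace (A ** A) = 3 * (y * y) + (x * x - y * y) * (v$1 * v$1 + v$2 * v$2 + v$3 * v$3)"
      by (simp add: trace_def sum_3 A2 algebra_simps)
    then show ?thesis by (simp add: v')
  qed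
  have sym: "transpose A = A" by (simp add: transpose_def vec_eq_iff A mult.commute)
  have "4 * (l - 4) * (x * x - y * y) + (16 * (x + 2 * y) - 2) * (x - y) = 0"
    using x[THEN diff_zeroI] by algebra
  then have w: "4 * (l - 4) * ((x * x - y * y) * w) + (16 * (x + 2 * y) - 2) * ((x - y) * w) = 0" for w
    by algebra
  have y': "4 * (l - 4) * (y * y) + (16 * (x + 2 * y) - 2) * y = 4 * ((x + 2 * y)^2 - (x * x + 2 * (y * y)))"
    using y[THEN diff_zeroI] by algebra
  have "4 * (l - 4) * (A ** A)$i$j + (16 * (x + 2 * y) - 2) * A$i$j
      = (if i = j then 4 * ((x + 2 * y)^2 - (x * x + 2 * (y * y))) else 0)" for i j
  proof -
    have "4 * (l - 4) * (A ** A)$i$j + (16 * (x + 2 * y) - 2) * A$i$j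
      = (if i = j then 4 * (l - 4) * (y * y) + (16 * (x + 2 * y) - 2) * y else 0)
        + (4 * (l - 4) * ((x * x - y * y) * (v$i * v$j)) + (16 * (x + 2 * y) - 2) * ((x - y) * (v$i * v$j)))"
    proof -
      have "4 * (l - 4) * (d * (y * y) + (x * x - y * y) * w) + (16 * (x + 2 * y) - 2) * (d * y + (x - y) * w)
        = d * (4 * (l - 4) * (y * y) + (16 * (x + 2 * y) - 2) * y)
        + (4 * (l - 4) * ((x * x - y * y) * w) + (16 * (x + 2 * y) - 2) * ((x - y) * w))" for d w
        by algebra
      from this[of 1 "v$i * v$j"] this[of 0 "v$i * v$j"] show ?thesis
        unfolding A A2 by (cases "i = j") (simp_all only: if_True if_False mult_1_left mult_zero_left simp_thms add_0)
    qed
    then show ?thesis by (simp only: w y' add_0_right)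
  qed
  with sym show ?thesis
    unfolding A_def[symmetric] semi_conformal_matrix_def tr tr2 by blast
qed

lemma semi_conformal_matrix_cases:
  assumes A: "semi_conformal_matrix l A" and l: "l \<notin> {-2, 0, 1, 4}"
  obtains x where "A = mat x" "x = 0 \<or> x = 1 / (2 * (l + 2))"
  | v :: "complex ^ 3" where "(\<Sum>i\<in>UNIV. v$i * v$i) = 1"
      "A = axial_matrix (1 / (2 * l)) 0 v"
  | v :: "complex ^ 3" where "(\<Sum>i\<in>UNIV. v$i * v$i) = 1"
      "A = axial_matrix (- 1 / (l * (l + 2))) (1 / (2 * (l + 2))) v"
proof -
  note scalar = that(1) and first = that(2) and second = that(3)
  have l': "l - 4 \<noteq> 0" "l - 1 \<noteq> 0" "l \<noteq> 0" "l + 2 \<noteq> 0"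
    using l by (auto simp: add_eq_0_iff2)
  define t where "t = trace A"
  define s where "s = trace (A ** A)"
  \<comment> \<open>Solving the equation for A^2, possible as l is not 4, yields A^2 = p A +
    r.\<close>
  define p where "p = (1 - 8 * t) / (2 * (l - 4))"
  define r where "r = (t * t - s) / (l - 4)"
  have p: "2 * (l - 4) * p = 1 - 8 * t" using l' by (simp add: p_def)
  have r: "(l - 4) * r = t * t - s" using l' by (simp add: r_def)
  have sym: "transpose A = A" using A by (simp add: semi_conformal_matrix_def)
  have A2: "(A ** A)$i$j = p * A$i$j + (if i = j then r else 0)" for i j
  proof -
    define X a where "X = (A ** A)$i$j" and "a = A$i$j"
    have e: "4 * (l - 4) * X + (16 * t - 2) * a = (if i = j then 4 * (t^2 - s) else 0)"
      using A by (simp add: semi_conformal_matrix_def t_def s_def X_def a_def)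
    have "4 * (l - 4) * X = 4 * (l - 4) * (p * a + (if i = j then r else 0))"
    proof (cases "i = j")
      case True
      have "4 * (l - 4) * X + (16 * t - 2) * a - 4 * (t^2 - s) = 0" using e True by simp
      then have "4 * (l - 4) * X = 4 * (l - 4) * (p * a + r)"
        using p[THEN diff_zeroI] r[THEN diff_zeroI] by algebra
      with True show ?thesis by simp
    next
      case False
      have "4 * (l - 4) * X + (16 * t - 2) * a = 0" using e False by simp
      then have "4 * (l - 4) * X = 4 * (l - 4) * (p * a)" using p[THEN diff_zeroI] by algebra
      with False show ?thesis by simp
    qed
    then have "X = p * a + (if i = j then r else 0)" using l' by simp
    then show ?thesis by (simp add: X_def a_def)
  qed
  have A3: "(A ** A ** A)$i$j = p * (A ** A)$i$j + r * A$i$j" for i j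
  proof -
    have "(A ** A ** A)$i$j = (\<Sum>k\<in>UNIV. p * (A$i$k * A$k$j) + (if i = k then r * A$k$j else 0))"
      by (subst matrix_matrix_mult_def, simp only: vec_lambda_beta, rule sum.cong) (auto simp: A2 algebra_simps)
    also have "\<dots> = p * (A ** A)$i$j + r * A$i$j"
      by (simp add: sum.distrib matrix_matrix_mult_def sum_distrib_left)
    finally show ?thesis .
  qed
  have s: "s = p * t + 3 * r"
    by (simp add: s_def t_def trace_def A2 sum.distrib sum_distrib_left)
  \<comment> \<open>The coefficient of A after A^3 and A^2 are reduced by A^2 = p A + r in the
    Cayley-Hamilton identity. That identity becomes q A = scalar, so A is scalar unless q =
    0.\<close>
  define q where "q = p * p + r - t * p + (t * t - s) / 2"
  have ch: "q * A$i$j = (if i = j then det A + t * r - p * r else 0)" for i j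
  proof -
    have "p * (A ** A)$i$j + r * A$i$j = t * (A ** A)$i$j - (t\<^sup>2 - s) / 2 * A$i$j + (if i = j then det A else 0)"
      using cayley_hamilton_3[of A i j] by (simp only: A3 t_def s_def)
    then show ?thesis
      unfolding A2 q_def by (cases "i = j") (simp_all add: field_simps power2_eq_square)
  qed
  show ?thesis
  proof (cases "q = 0")
    case False
    define x where "x = (det A + t * r - p * r) / q"
    have "A = mat x"
      unfolding vec_eq_iff mat_def
    proof (intro allI)
      fix i j
      show "A$i$j = (\<chi> i j. if i = j then x else 0)$i$j"
        using ch[of i j] False by (cases "i = j") (simp_all add: x_def field_simps)
    qed
    moreover have "x = 0 \<or> x = 1 / (2 * (l + 2))"
      using A l semi_conformal_matrix_scalar[of l x] calculation by auto
    ultimately show ?thesis using scalar by blast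
  next
    case True
    have tr: "(t - p) * (t - 2 * p) = r"
      using True s[THEN diff_zeroI] unfolding q_def by algebra
    have tp: "t * (t - p) = (l - 1) * r" using r[THEN diff_zeroI] s[THEN diff_zeroI] by algebra
    have projection: thesis if y: "p - y = x" "- x * y = r" "x + 2 * y = t" and ne: "x \<noteq> y"
      and goal: "\<And>v :: complex ^ 3. (\<Sum>i\<in>UNIV. v$i * v$i) = 1 \<Longrightarrow> A = axial_matrix x y v \<Longrightarrow> thesis"
      for x y
    proof -
      \<comment> \<open>The spectral projection for x: A^2 = p A + r factors as (A - x)(A - y) = 0,
        so P is idempotent, and t = x + 2y forces its trace to be 1.\<close>
      define P :: "complex ^ 3 ^ 3" where "P = (\<chi> i j. (A$i$j - (if i = j then y else 0)) / (x - y))"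
      have P: "A$i$j = (if i = j then y else 0) + (x - y) * P$i$j" for i j
        using ne by (simp add: P_def)
      have ne': "x - y \<noteq> 0" using ne by simp
      have 1: "transpose P = P"
        using sym by (simp add: P_def transpose_def vec_eq_iff)
      have 2: "P ** P = P"
      proof -
        have "(P ** P)$i$j = P$i$j" for i j
        proof -
          have "(A ** A)$i$j = (\<Sum>k\<in>UNIV. (if i = k then y * A$k$j else 0) + ((if k = j then y * (x - y) * P$i$k else 0) + (x - y) * (x - y) * (P$i$k * P$k$j)))"
            unfolding matrix_matrix_mult_def by (simp, rule sum.cong) (auto simp: P algebra_simps)
          also have "\<dots> = y * A$i$j + (y * (x - y) * P$i$j + (x - y) * (x - y) * (P ** P)$i$j)"
            by (simp add: sum.distrib matrix_matrix_mult_def sum_distrib_left)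
          finally have e: "p * A$i$j + (if i = j then r else 0) = y * A$i$j + (y * (x - y) * P$i$j + (x - y) * (x - y) * (P ** P)$i$j)"
            by (simp only: A2)
          define a b c where "a = A$i$j" and "b = P$i$j" and "c = (P ** P)$i$j"
          note abc = a_def[symmetric] b_def[symmetric] c_def[symmetric]
          have "(x - y) * (x - y) * b = (x - y) * (x - y) * c"
          proof (cases "i = j")
            case True
            have "p * a + r - (y * a + (y * (x - y) * b + (x - y) * (x - y) * c)) = 0"
              using e True unfolding abc by simp
            moreover have "a - (y + (x - y) * b) = 0" using P[of i j] True unfolding abc by simp
            ultimately show ?thesis using y(1,2)[THEN diff_zeroI] by algebra
          next
            case False
            have "p * a - (y * a + (y * (x - y) * b + (x - y) * (x - y) * c)) = 0"
              using e False unfolding abc by simp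
            moreover have "a - (x - y) * b = 0" using P[of i j] False unfolding abc by simp
            ultimately show ?thesis using y(1,2)[THEN diff_zeroI] by algebra
          qed
          then have "(x - y) * (x - y) * P$i$j = (x - y) * (x - y) * (P ** P)$i$j"
            by (simp only: a_def b_def c_def)
          then show ?thesis using ne' by simp
        qed
        then show ?thesis by (simp add: vec_eq_iff)
      qed
      have "3 * y + (x - y) * trace P = t"
        unfolding t_def trace_def by (simp add: P sum.distrib sum_distrib_left)
      then have "(x - y) * trace P = (x - y) * 1" unfolding y(3)[symmetric] by (simp add: algebra_simps)
      then have 3: "trace P = 1" using ne' by (simp only: mult_cancel_left) simp
      obtain v :: "complex ^ 3" where v: "(\<Sum>i\<in>UNIV. v$i * v$i) = 1" "\<And>i j. P$i$j = v$i * v$j"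
        using rank_one_projection[OF 1 2 3] by blast
      have "A = axial_matrix x y v"
        by (simp add: axial_matrix_def vec_eq_iff P v(2))
      with v(1) show thesis by (rule goal)
    qed
    show ?thesis
    proof (cases "t = p")
      case True
      \<comment> \<open>Here \<open>tr\<close> gives r = 0, so the eigenvalues are p and 0, and the
        defining relation of \<open>p\<close> fixes p = t.\<close>
      have "2 * l * t = 1" using p[THEN diff_zeroI] True[THEN diff_zeroI] by algebra
      then have t: "t = 1 / (2 * l)" using l' by (simp add: field_simps)
      show ?thesis
      proof (rule projection[of 0 "1 / (2 * l)"])
        show "p - 0 = 1 / (2 * l)" "- (1 / (2 * l)) * 0 = r" "1 / (2 * l) + 2 * 0 = t"
          using True t tr by simp_all
        show "1 / (2 * l) \<noteq> 0" using l' by simp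
        show thesis if "(\<Sum>i\<in>UNIV. v$i * v$i) = 1"
          "A = axial_matrix (1 / (2 * l)) 0 v" for v :: "complex ^ 3"
          using first[OF that] .
      qed
    next
      case False
      \<comment> \<open>Eliminating r between \<open>tr\<close> and \<open>tp\<close> and cancelling
        t - p leaves two linear equations for t and p. Their solution, which divides by l - 1,
        yields the eigenvalues in \<open>A4\<close>.\<close>
      have "(t - p) * (t - (l - 1) * (t - 2 * p)) = 0" using tr[THEN diff_zeroI] tp[THEN diff_zeroI] by algebra
      then have e: "t = (l - 1) * (t - 2 * p)" using False by simp
      have t: "(l * (l + 2)) * t = l - 1" using e[THEN diff_zeroI] p[THEN diff_zeroI] by algebra
      have "(l - 1) * (2 * l * (l + 2) * p) = (l - 1) * (l - 2)"
        using e[THEN diff_zeroI] t[THEN diff_zeroI] by algebra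
      then have p': "2 * l * (l + 2) * p = l - 2" using l' by simp
            define x0 y0 where "x0 = - 1 / (l * (l + 2))" and "y0 = 1 / (2 * (l + 2))"
      have x0: "l * (l + 2) * x0 = - 1" and y0: "2 * (l + 2) * y0 = 1"
        using l' divide_self[of "2 * (l + 2)"] by (simp_all add: x0_def y0_def del: distrib_left_numeral)
      have 1: "p - y0 = x0"
      proof -
        have "2 * l * (l + 2) * (p - y0) = 2 * l * (l + 2) * x0"
          using p'[THEN diff_zeroI] x0[THEN diff_zeroI] y0[THEN diff_zeroI] by algebra
        then show ?thesis using l' by simp
      qed
      have 2: "x0 + 2 * y0 = t"
      proof -
        have "l * (l + 2) * (x0 + 2 * y0) = l * (l + 2) * t"
          using t[THEN diff_zeroI] x0[THEN diff_zeroI] y0[THEN diff_zeroI] by algebra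
        then show ?thesis using l' by simp
      qed
      have 3: "- x0 * y0 = r"
        using tr[THEN diff_zeroI] 1[THEN diff_zeroI] 2[THEN diff_zeroI] by algebra
      have 4: "x0 \<noteq> y0"
      proof
        assume "x0 = y0"
        from this[THEN diff_zeroI] have "(l + 2) * 1 = 0"
          using x0[THEN diff_zeroI] y0[THEN diff_zeroI] by algebra
        then show False using l' by simp
      qed
      show ?thesis
        using projection[OF 1 3 2 4 second[folded x0_def y0_def]] .
    qed
  qed
qed

section \<open>Affine vertex algebras\<close>

definition levi_civita :: "3 \<Rightarrow> 3 \<Rightarrow> 3 \<Rightarrow> complex" where
  "levi_civita i j k = (if (i, j, k) \<in> {(1,2,3), (2,3,1), (3,1,2)} then 1
     else if (i, j, k) \<in> {(2,1,3), (3,2,1), (1,3,2)} then -1 else 0)"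

text \<open>In the basis \<open>alpha\<close>, sl_2 is complex 3-space with the cross product scaled
  by a square root of -2.\<close>

definition structure_const :: "3 \<Rightarrow> 3 \<Rightarrow> 3 \<Rightarrow> complex" where
  "structure_const i j k = csqrt (-2) * levi_civita i j k"

lemma csqrt_squares: "csqrt 2 * csqrt 2 = 2" "csqrt (-2) * csqrt (-2) = -2"
  using power2_csqrt[of 2] power2_csqrt[of "-2"] by (simp_all only: power2_eq_square)

lemma csqrt_nonzero: "csqrt 2 \<noteq> 0" "csqrt (-2) \<noteq> 0"
  by auto

lemma alpha_coordinates:
  "alpha 1 = vector [0, 1 / csqrt 2, 1 / csqrt 2]"
  "alpha 2 = vector [0, 1 / csqrt (-2), - 1 / csqrt (-2)]"
  "alpha 3 = vector [1 / csqrt 2, 0, 0]"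
  by (simp_all add: alpha_def sl2_h_def sl2_e_def sl2_f_def vec_eq_iff forall_3)

lemma alpha_bracket: "sl2_bracket (alpha i) (alpha j) = (\<Sum>k\<in>UNIV. structure_const i j k *s alpha k)"
proof -
  \<comment> \<open>Naming the roots leaves only their squares and nonvanishing to the
    simplifier.\<close>
  define r s where "r = csqrt 2" and "s = csqrt (-2)"
  have "r * r = 2" "s * s = -2" "r \<noteq> 0" "s \<noteq> 0"
    using csqrt_squares csqrt_nonzero by (simp_all add: r_def s_def)
  then show ?thesis
    unfolding structure_const_def using exhaust_3[of i] exhaust_3[of j]
    by (elim disjE; simp add: alpha_coordinates r_def[symmetric] s_def[symmetric] sum_3 vec_eq_iff forall_3
        sl2_bracket_def levi_civita_def field_simps)
qed

lemma alpha_expansion: "a = (\<Sum>k\<in>UNIV. sl2_form a (alpha k) *s alpha k)"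
proof -
  define r s where "r = csqrt 2" and "s = csqrt (-2)"
  have "r * r = 2" "s * s = -2" "r \<noteq> 0" "s \<noteq> 0"
    using csqrt_squares csqrt_nonzero by (simp_all add: r_def s_def)
  moreover from this have rs: "r * (r * x) = 2 * x" "s * (s * x) = - 2 * x" for x
    by (simp_all flip: mult.assoc)
  ultimately show ?thesis
    by (simp add: rs alpha_coordinates r_def[symmetric] s_def[symmetric] sum_3 vec_eq_iff forall_3
        sl2_form_def field_simps)
qed

lemma levi_civita_contract:
  "(\<Sum>k\<in>UNIV. levi_civita p i k * levi_civita k j r) =
    (if p = j \<and> i = r then 1 else 0) - (if i = j \<and> p = r then 1 else 0)"
  using exhaust_3[of i] exhaust_3[of j] exhaust_3[of p] exhaust_3[of r]
  by (elim disjE; simp add: sum_3 levi_civita_def)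

lemma structure_const_contract:
  "(\<Sum>k\<in>UNIV. structure_const p i k * structure_const k j r) =
    2 * (if i = j \<and> p = r then 1 else 0) - 2 * (if p = j \<and> i = r then 1 else 0)"
proof -
  have "(\<Sum>k\<in>UNIV. structure_const p i k * structure_const k j r)
      = (csqrt (-2) * csqrt (-2)) * (\<Sum>k\<in>UNIV. levi_civita p i k * levi_civita k j r)"
    unfolding structure_const_def sum_distrib_left by (simp only: ac_simps)
  then show ?thesis by (simp only: csqrt_squares levi_civita_contract) simp
qed

lemma levi_civita_antisym: "levi_civita i j k = - levi_civita j i k"
  using exhaust_3[of i] exhaust_3[of j] exhaust_3[of k]
  by (elim disjE; simp add: levi_civita_def)

lemma levi_civita_antisym': "levi_civita i j k = - levi_civita i k j"
  using exhaust_3[of i] exhaust_3[of j] exhaust_3[of k]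
  by (elim disjE; simp add: levi_civita_def)

lemma structure_const_antisym: "structure_const i j k = - structure_const j i k" and structure_const_antisym': "structure_const i j k = - structure_const i k j"
  unfolding structure_const_def
  using levi_civita_antisym[of i j k] levi_civita_antisym'[of i j k] by auto

lemma sum_symmetric_antisymmetric:
  fixes A :: "complex ^ 3 ^ 3"
  assumes "\<And>i j. A$i$j = A$j$i" "\<And>i j. c i j = - c j i"
  shows "(\<Sum>i\<in>UNIV. \<Sum>j\<in>UNIV. A$i$j * c i j) = 0"
proof -
  have "(\<Sum>i\<in>UNIV. \<Sum>j\<in>UNIV. A$i$j * c i j) = (\<Sum>j\<in>UNIV. \<Sum>i\<in>UNIV. A$i$j * c i j)"
    by (rule sum.swap)
  also have "\<dots> = (\<Sum>j\<in>UNIV. \<Sum>i\<in>UNIV. - (A$j$i * c j i))"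
    by (intro sum.cong refl) (metis assms mult_minus_right)
  also have "\<dots> = - (\<Sum>i\<in>UNIV. \<Sum>j\<in>UNIV. A$i$j * c i j)"
    by (simp add: sum_negf)
  finally show ?thesis by simp
qed

text \<open>The adjoint action of \<open>alpha p\<close> extended to 2-tensors as a derivation; on
  quadratic vectors it is the zero mode of the current.\<close>

definition adjoint_action :: "3 \<Rightarrow> complex ^ 3 ^ 3 \<Rightarrow> complex ^ 3 ^ 3" where
  "adjoint_action p A = (\<chi> i j. \<Sum>k\<in>UNIV. structure_const p k i * A$k$j + structure_const p k j * A$i$k)"

text \<open>The contribution of the products of two zero modes to the product of a quadratic vector
  with itself.\<close>

lemma adjoint_action_twice:
  fixes A :: "complex ^ 3 ^ 3"
  assumes sym: "transpose A = A"
  shows "(\<Sum>p\<in>UNIV. \<Sum>q\<in>UNIV. A$p$q * (adjoint_action q (adjoint_action p A))$i$j)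
    = - 12 * (A ** A)$i$j + 12 * trace A * A$i$j - (if i = j then 4 * (trace A ^ 2 - trace (A ** A)) else 0)"
proof -
  have s: "A$2$1 = A$1$2" "A$3$1 = A$1$3" "A$3$2 = A$2$3"
    using symmetric_entry[OF sym] by blast+
  define c where "c = csqrt (-2)"
  have c: "c * (c * x) = -2 * x" for x
    by (simp only: c_def csqrt_squares mult.assoc[symmetric])
  have structure_const: "structure_const = (\<lambda>i j k. c * levi_civita i j k)"
    by (simp add: structure_const_def c_def fun_eq_iff)
  have entry: "adjoint_action 1 B$1$1 = 0"
    "adjoint_action 1 B$1$2 = c * ((- B$1$3))"
    "adjoint_action 1 B$1$3 = c * ((B$1$2))"
    "adjoint_action 1 B$2$1 = c * ((- B$3$1))"
    "adjoint_action 1 B$2$2 = c * ((- B$3$2) + (- B$2$3))"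
    "adjoint_action 1 B$2$3 = c * ((- B$3$3) + (B$2$2))"
    "adjoint_action 1 B$3$1 = c * ((B$2$1))"
    "adjoint_action 1 B$3$2 = c * ((B$2$2) + (- B$3$3))"
    "adjoint_action 1 B$3$3 = c * ((B$2$3) + (B$3$2))"
    "adjoint_action 2 B$1$1 = c * ((B$3$1) + (B$1$3))"
    "adjoint_action 2 B$1$2 = c * ((B$3$2))"
    "adjoint_action 2 B$1$3 = c * ((B$3$3) + (- B$1$1))"
    "adjoint_action 2 B$2$1 = c * ((B$2$3))"
    "adjoint_action 2 B$2$2 = 0"
    "adjoint_action 2 B$2$3 = c * ((- B$2$1))"
    "adjoint_action 2 B$3$1 = c * ((- B$1$1) + (B$3$3))"
    "adjoint_action 2 B$3$2 = c * ((- B$1$2))"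
    "adjoint_action 2 B$3$3 = c * ((- B$1$3) + (- B$3$1))"
    "adjoint_action 3 B$1$1 = c * ((- B$2$1) + (- B$1$2))"
    "adjoint_action 3 B$1$2 = c * ((- B$2$2) + (B$1$1))"
    "adjoint_action 3 B$1$3 = c * ((- B$2$3))"
    "adjoint_action 3 B$2$1 = c * ((B$1$1) + (- B$2$2))"
    "adjoint_action 3 B$2$2 = c * ((B$1$2) + (B$2$1))"
    "adjoint_action 3 B$2$3 = c * ((B$1$3))"
    "adjoint_action 3 B$3$1 = c * ((- B$3$2))"
    "adjoint_action 3 B$3$2 = c * ((B$3$1))"
    "adjoint_action 3 B$3$3 = 0" for B
    by (simp_all add: adjoint_action_def sum_3 structure_const levi_civita_def algebra_simps)
  show ?thesis
    using exhaust_3[of i] exhaust_3[of j]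
    by (elim disjE; simp add: sum_3 entry matrix_matrix_mult_def trace_def s c power2_eq_square algebra_simps)
qed

text \<open>
  Both the universal affine vertex algebra and its quotients are of this kind; generation by the
  currents replaces the exact description of the underlying module.
\<close>

locale affine_vertex_algebra = full_vertex_algebra smul Y vac
  for smul :: "complex \<Rightarrow> 'v::ab_group_add \<Rightarrow> 'v" and Y :: "'v \<Rightarrow> int \<Rightarrow> 'v \<Rightarrow> 'v" and vac +
  fixes l :: complex and \<iota> :: "sl2 \<Rightarrow> 'v"
  assumes iota_linear: "\<iota> (x *s a + y *s b) = smul x (\<iota> a) + smul y (\<iota> b)"
    and current_commutator: "Y (\<iota> a) m (Y (\<iota> b) n v) - Y (\<iota> b) n (Y (\<iota> a) m v) =
      Y (\<iota> (sl2_bracket a b)) (m + n) v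
      + smul (if m + n = 0 then of_int m * sl2_form a b * l else 0) v"
    and generated: "\<lbrakk>subspace S; vac \<in> S; \<And>a n v. v \<in> S \<Longrightarrow> Y (\<iota> a) n v \<in> S\<rbrakk> \<Longrightarrow> v \<in> S"
    and noncritical: "l + 2 \<noteq> 0"
begin

section \<open>Currents acting on quadratic vectors\<close>

lemma iota_add: "\<iota> (a + b) = \<iota> a + \<iota> b"
  using iota_linear[of 1 a 1 b] by simp

lemma iota_scale: "\<iota> (x *s a) = smul x (\<iota> a)"
  using iota_linear[of x a 0 a] by simp

lemma iota_zero: "\<iota> 0 = 0"
  using iota_scale[of 0 0] by simp

lemma iota_sum: "\<iota> (\<Sum>i\<in>I. f i) = (\<Sum>i\<in>I. \<iota> (f i))"
  by (induction I rule: infinite_finite_induct) (simp_all add: iota_add iota_zero)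

definition J :: "3 \<Rightarrow> int \<Rightarrow> 'v \<Rightarrow> 'v" where "J i n v = Y (\<iota> (alpha i)) n v"

lemma J_zero [simp]: "J i n 0 = 0"
  and J_add: "J i n (v + w) = J i n v + J i n w"
  and J_scale: "J i n (smul c v) = smul c (J i n v)"
  and J_sum: "J i n (\<Sum>x\<in>I. f x) = (\<Sum>x\<in>I. J i n (f x))"
  and J_vac [simp]: "n \<ge> 0 \<Longrightarrow> J i n vac = 0"
  by (simp_all add: J_def Y_add_right Y_scale_right Y_sum_right)

lemma Y_iota: "Y (\<iota> a) n v = (\<Sum>k\<in>UNIV. smul (sl2_form a (alpha k)) (J k n v))"
  by (subst alpha_expansion) (simp add: iota_sum iota_scale Y_sum_left Y_scale_left J_def)

lemma J_commutator:
  "J i m (J j n v) = J j n (J i m v) + (\<Sum>k\<in>UNIV. smul (structure_const i j k) (J k (m + n) v))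
    + smul (if m + n = 0 \<and> i = j then of_int m * l else 0) v"
proof -
  have "J i m (J j n v) - J j n (J i m v) = (\<Sum>k\<in>UNIV. smul (structure_const i j k) (J k (m + n) v))
      + smul (if m + n = 0 \<and> i = j then of_int m * l else 0) v"
    unfolding J_def current_commutator alpha_bracket alpha_orthonormal
    by (simp add: iota_sum iota_scale Y_sum_left Y_scale_left)
  then show ?thesis by (simp add: algebra_simps)
qed

lemma generated_J:
  assumes "subspace S" "vac \<in> S" "\<And>i n v. v \<in> S \<Longrightarrow> J i n v \<in> S"
  shows "v \<in> S"
  using assms(1,2)
  by (rule generated) (auto simp: Y_iota intro!: subspace_sum[OF assms(1)] subspace_scale[OF assms(1)] assms(3))

lemma J_current_0: "J p 0 (J j (-1) vac) = (\<Sum>k\<in>UNIV. smul (structure_const p j k) (J k (-1) vac))"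
  by (subst J_commutator) simp

lemma J_current_1: "J p 1 (J j (-1) vac) = smul (if p = j then l else 0) vac"
  by (subst J_commutator) simp

lemma J_current_high: "n \<ge> 2 \<Longrightarrow> J p n (J j (-1) vac) = 0"
  by (subst J_commutator) simp

definition Q :: "complex ^ 3 ^ 3 \<Rightarrow> 'v" where
  "Q A = (\<Sum>i\<in>UNIV. \<Sum>j\<in>UNIV. smul (A$i$j) (J i (-1) (J j (-1) vac)))"

lemma Q_omega_mat: "Q A = omega_mat smul Y vac \<iota> A"
  by (simp add: Q_def omega_mat_def J_def)

lemma Q_add: "Q (A + B) = Q A + Q B"
  by (simp add: Q_def scale_left_distrib sum.distrib)

lemma Q_zero [simp]: "Q 0 = 0"
  by (simp add: Q_def)

lemma Q_scale: "Q (\<chi> i j. c * A$i$j) = smul c (Q A)"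
  by (simp add: Q_def scale_sum_right)

lemma Q_sum: "Q (\<Sum>x\<in>I. f x) = (\<Sum>x\<in>I. Q (f x))"
  by (induction I rule: infinite_finite_induct) (simp_all add: Q_add)

lemma J_quadratic_0: "J p 0 (J i (-1) (J j (-1) vac)) =
  (\<Sum>k\<in>UNIV. smul (structure_const p j k) (J i (-1) (J k (-1) vac)))
  + (\<Sum>k\<in>UNIV. smul (structure_const p i k) (J k (-1) (J j (-1) vac)))"
  by (subst J_commutator) (simp add: J_current_0 J_sum J_scale)

lemma J_quadratic_1: "J p 1 (J i (-1) (J j (-1) vac)) =
  (\<Sum>r\<in>UNIV. smul ((\<Sum>k\<in>UNIV. structure_const p i k * structure_const k j r)
    + (if p = i \<and> j = r then l else 0) + (if p = j \<and> i = r then l else 0)) (J r (-1) vac))"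
proof -
  have "J p 1 (J i (-1) (J j (-1) vac)) = smul (if p = j then l else 0) (J i (-1) vac)
      + (\<Sum>k\<in>UNIV. smul (structure_const p i k) (\<Sum>r\<in>UNIV. smul (structure_const k j r) (J r (-1) vac)))
      + smul (if p = i then l else 0) (J j (-1) vac)"
    by (subst J_commutator) (simp add: J_current_0 J_current_1 J_scale)
  also have "(\<Sum>k\<in>UNIV. smul (structure_const p i k) (\<Sum>r\<in>UNIV. smul (structure_const k j r) (J r (-1) vac)))
      = (\<Sum>r\<in>UNIV. smul (\<Sum>k\<in>UNIV. structure_const p i k * structure_const k j r) (J r (-1) vac))"
    by (simp add: scale_sum_right scale_sum_left) (rule sum.swap)
  also have "smul (if p = j then l else 0) (J i (-1) vac)
      = (\<Sum>r\<in>UNIV. smul (if p = j \<and> i = r then l else 0) (J r (-1) vac))"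
    by (simp add: if_distribR if_distrib[of "\<lambda>x. smul x _"] cong: if_cong)
  also have "smul (if p = i then l else 0) (J j (-1) vac)
      = (\<Sum>r\<in>UNIV. smul (if p = i \<and> j = r then l else 0) (J r (-1) vac))"
    by (simp add: if_distribR if_distrib[of "\<lambda>x. smul x _"] cong: if_cong)
  finally show ?thesis
    by (simp add: scale_left_distrib sum.distrib)
qed

lemma J_quadratic_2: "J p 2 (J i (-1) (J j (-1) vac)) = smul (l * structure_const p i j) vac"
  by (subst J_commutator)
    (simp add: J_current_1 J_current_high if_distrib[of "\<lambda>x. smul x _"] if_distrib[of "smul _"] mult.commute cong: if_cong)

lemma J_quadratic_high: "n \<ge> 3 \<Longrightarrow> J p n (J i (-1) (J j (-1) vac)) = 0"
  by (subst J_commutator) (simp add: J_current_high)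

lemma J_Q_0: "J p 0 (Q A) = Q (adjoint_action p A)"
proof -
  have "J p 0 (Q A) = (\<Sum>i\<in>UNIV. \<Sum>j\<in>UNIV. \<Sum>k\<in>UNIV. smul (A$i$j * structure_const p j k) (J i (-1) (J k (-1) vac)))
      + (\<Sum>i\<in>UNIV. \<Sum>j\<in>UNIV. \<Sum>k\<in>UNIV. smul (A$i$j * structure_const p i k) (J k (-1) (J j (-1) vac)))"
    by (simp add: Q_def J_sum J_scale J_quadratic_0 scale_right_distrib sum.distrib scale_sum_right)
  also have "(\<Sum>i\<in>UNIV. \<Sum>j\<in>UNIV. \<Sum>k\<in>UNIV. smul (A$i$j * structure_const p j k) (J i (-1) (J k (-1) vac)))
      = (\<Sum>i\<in>UNIV. \<Sum>k\<in>UNIV. smul (\<Sum>j\<in>UNIV. structure_const p j k * A$i$j) (J i (-1) (J k (-1) vac)))"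
    by (rule sum.cong[OF refl], subst sum.swap) (simp add: scale_sum_left mult.commute)
  also have "(\<Sum>i\<in>UNIV. \<Sum>j\<in>UNIV. \<Sum>k\<in>UNIV. smul (A$i$j * structure_const p i k) (J k (-1) (J j (-1) vac)))
      = (\<Sum>k\<in>UNIV. \<Sum>j\<in>UNIV. smul (\<Sum>i\<in>UNIV. structure_const p i k * A$i$j) (J k (-1) (J j (-1) vac)))"
    by (subst sum.swap, subst (2) sum.swap, subst sum.swap) (simp add: scale_sum_left mult.commute)
  finally show ?thesis
    by (simp add: Q_def adjoint_action_def sum.distrib scale_left_distrib)
qed

text \<open>The two central terms contribute 2 l A, and the contracted structure constants
  contribute -2 A + 2 tr A.\<close>

lemma J_Q_1:
  assumes sym: "transpose A = A"
  shows "J p 1 (Q A) = (\<Sum>r\<in>UNIV. smul ((2 * l - 2) * A$p$r + (if p = r then 2 * trace A else 0)) (J r (-1) vac))"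
proof -
  have coefficient: "(\<Sum>i\<in>UNIV. \<Sum>j\<in>UNIV. A$i$j * ((\<Sum>k\<in>UNIV. structure_const p i k * structure_const k j r)
    + (if p = i \<and> j = r then l else 0) + (if p = j \<and> i = r then l else 0)))
    = (2 * l - 2) * A$p$r + (if p = r then 2 * trace A else 0)" for r
  proof -
    have s: "A$2$1 = A$1$2" "A$3$1 = A$1$3" "A$3$2 = A$2$3"
      using symmetric_entry[OF sym] by blast+
    show ?thesis
      unfolding structure_const_contract using exhaust_3[of p] exhaust_3[of r]
      by (elim disjE; simp add: sum_3 s trace_def algebra_simps)
  qed
  have "J p 1 (Q A) = (\<Sum>i\<in>UNIV. \<Sum>j\<in>UNIV. \<Sum>r\<in>UNIV. smul (A$i$j * ((\<Sum>k\<in>UNIV. structure_const p i k * structure_const k j r)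
    + (if p = i \<and> j = r then l else 0) + (if p = j \<and> i = r then l else 0))) (J r (-1) vac))"
    by (simp add: Q_def J_sum J_scale J_quadratic_1 scale_sum_right)
  also have "\<dots> = (\<Sum>r\<in>UNIV. \<Sum>i\<in>UNIV. \<Sum>j\<in>UNIV. smul (A$i$j * ((\<Sum>k\<in>UNIV. structure_const p i k * structure_const k j r)
    + (if p = i \<and> j = r then l else 0) + (if p = j \<and> i = r then l else 0))) (J r (-1) vac))"
    by (subst (2) sum.swap, subst sum.swap) simp
  also have "\<dots> = (\<Sum>r\<in>UNIV. smul (\<Sum>i\<in>UNIV. \<Sum>j\<in>UNIV. A$i$j * ((\<Sum>k\<in>UNIV. structure_const p i k * structure_const k j r)
    + (if p = i \<and> j = r then l else 0) + (if p = j \<and> i = r then l else 0))) (J r (-1) vac))"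
    by (simp add: scale_sum_left)
  finally show ?thesis by (simp only: coefficient)
qed

text \<open>The coefficient pairs the symmetric \<open>A\<close> with antisymmetric structure
  constants.\<close>

lemma J_Q_2:
  assumes sym: "transpose A = A"
  shows "J p 2 (Q A) = 0"
proof -
  have "J p 2 (Q A) = smul (l * (\<Sum>i\<in>UNIV. \<Sum>j\<in>UNIV. A$i$j * structure_const p i j)) vac"
    by (simp add: Q_def J_sum J_scale J_quadratic_2 scale_sum_left sum_distrib_left ac_simps)
  also have "(\<Sum>i\<in>UNIV. \<Sum>j\<in>UNIV. A$i$j * structure_const p i j) = 0"
    by (rule sum_symmetric_antisymmetric)
      (rule symmetric_entry[OF sym], rule structure_const_antisym')
  finally show ?thesis by simp
qed

lemma J_Q_high: "n \<ge> 3 \<Longrightarrow> J p n (Q A) = 0"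
  by (simp add: Q_def J_sum J_scale J_quadratic_high)

section \<open>The Sugawara vector\<close>

definition \<omega> where "\<omega> = Q (mat (1 / (2 * (l + 2))))"

lemma affine_omega_eq: "affine_omega smul Y vac l \<iota> = \<omega>"
  by (simp add: \<omega>_def affine_omega_def Q_def mat_def J_def scale_sum_right if_distrib[of "\<lambda>x. smul x _"] cong: if_cong)

lemma transpose_mat: "transpose (mat x :: complex ^ 3 ^ 3) = mat x"
  by (auto simp: transpose_def mat_def vec_eq_iff)

lemma J_omega_0: "J p 0 \<omega> = 0"
proof -
  have "adjoint_action p (mat x) = 0" for x
  proof -
    have "(\<Sum>k\<in>UNIV. structure_const p k i * (if k = j then x else 0) + structure_const p k j * (if i = k then x else 0)) = 0" for i j
      using structure_const_antisym'[of p i j] by (simp add: sum.distrib if_distrib[of "\<lambda>y. _ * y"] cong: if_cong)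
    then show ?thesis by (simp add: adjoint_action_def mat_def vec_eq_iff)
  qed
  then show ?thesis by (simp add: \<omega>_def J_Q_0)
qed

text \<open>This fixes the normalization: a scalar matrix x has trace 3x, so the coefficient is (2l
  - 2)x + 6x = 2(l + 2)x, which is 1.\<close>

lemma J_omega_1: "J p 1 \<omega> = J p (-1) vac"
proof -
  define x where "x = 1 / (2 * (l + 2))"
  have "(2 * l + 4) * x = 1"
  proof -
    have "2 * l + 4 = 2 * (l + 2)" by simp
    then show ?thesis
      using noncritical divide_self[of "2 * (l + 2)"] by (simp add: x_def del: distrib_left_numeral)
  qed
  then have *: "(2 * l - 2) * (mat x :: complex ^ 3 ^ 3)$p$r + (if p = r then 2 * trace (mat x :: complex ^ 3 ^ 3) else 0)
      = (if p = r then 1 else 0)" for r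
    by (simp add: mat_def trace_def algebra_simps)
  show ?thesis
    unfolding \<omega>_def x_def[symmetric] J_Q_1[OF transpose_mat] *
    by (simp add: if_distrib[of "\<lambda>x. smul x _"] cong: if_cong)
qed

lemma J_omega_high: "n \<ge> 2 \<Longrightarrow> J p n \<omega> = 0"
  using J_Q_2[OF transpose_mat] J_Q_high unfolding \<omega>_def
  by (cases "n = 2") auto

text \<open>Currents are primary of weight 1. The commutator is taken from the side of the current,
  whose nonnegative modes on \<omega> are already known.\<close>

lemma omega_J: "Y \<omega> n (J p m v) = J p m (Y \<omega> n v) - smul (of_int m) (J p (m + n - 1) v)"
proof -
  have "Y (\<iota> (alpha p)) m (Y \<omega> n v) - Y \<omega> n (Y (\<iota> (alpha p)) m v)
    = (\<Sum>i<2. smul (of_int m gchoose i) (Y (Y (\<iota> (alpha p)) (int i) \<omega>) (m + n - int i) v))"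
    by (rule mode_commutator) (simp add: J_omega_high[unfolded J_def])
  also have "\<dots> = smul (of_int m) (J p (m + n - 1) v)"
    using J_omega_0[of p] J_omega_1[of p] by (simp add: numeral_2_eq_2 J_def)
  finally show ?thesis by (simp add: J_def algebra_simps)
qed

lemma omega_1_J: "Y \<omega> 1 (J p m v) = J p m (Y \<omega> 1 v) - smul (of_int m) (J p m v)"
  using omega_J[of 1 p m v] by simp

text \<open>Both operators kill the vacuum and have the same commutators with the currents, which
  generate.\<close>

lemma omega_zero_mode: "Y \<omega> 0 v = Y v (-2) vac"
proof -
  have "v \<in> {v. Y \<omega> 0 v = Y v (-2) vac}"
  proof (rule generated_J)
    show "subspace {v. Y \<omega> 0 v = Y v (-2) vac}"
      by (rule subspaceI) (simp_all add: Y_add_left Y_add_right Y_scale_left Y_scale_right)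
    show "vac \<in> {v. Y \<omega> 0 v = Y v (-2) vac}" by (simp add: Y_vac_left)
    show "J i n v \<in> {v. Y \<omega> 0 v = Y v (-2) vac}" if "v \<in> {v. Y \<omega> 0 v = Y v (-2) vac}" for i n v
      using that omega_J[of 0 i n v] by (simp add: J_def translation_derivation)
  qed
  then show ?thesis by simp
qed

section \<open>Monomials in the currents and the weight grading\<close>

definition monomial :: "(3 \<times> nat) list \<Rightarrow> 'v" where
  "monomial ws = foldr (\<lambda>(i, k). J i (-1 - int k)) ws vac"

lemma monomial_simps [simp]:
  "monomial [] = vac" "monomial ((i, k) # ws) = J i (-1 - int k) (monomial ws)"
  by (simp_all add: monomial_def)

definition weight :: "(3 \<times> nat) list \<Rightarrow> nat" where
  "weight ws = (\<Sum>(i, k)\<leftarrow>ws. Suc k)"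

lemma weight_simps [simp]: "weight [] = 0" "weight ((i, k) # ws) = Suc k + weight ws"
  by (simp_all add: weight_def)

lemma omega_monomial: "Y \<omega> 1 (monomial ws) = smul (of_nat (weight ws)) (monomial ws)"
proof (induction ws)
  case (Cons w ws)
  obtain i k where w: "w = (i, k)" by fastforce
  have "Y \<omega> 1 (J i (-1 - int k) (monomial ws)) =
      smul (of_nat (weight ws)) (monomial (w # ws)) + smul (1 + of_nat k) (monomial (w # ws))"
    by (simp add: omega_1_J Cons J_scale w flip: scale_minus_left)
  then show ?case by (simp add: w ac_simps flip: scale_left_distrib)
qed simp

lemma span_J_closed:
  assumes "\<And>w. w \<in> W \<Longrightarrow> J i n w \<in> span W'" "v \<in> span W"
  shows "J i n v \<in> span W'"
proof -
  have "subspace {v. J i n v \<in> span W'}"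
    by (rule subspaceI) (auto simp: J_add J_scale intro: span_add span_scale span_zero)
  with assms(2) show ?thesis
    by (rule span_induct[where P = "\<lambda>v. J i n v \<in> span W'"]) (use assms(1) in auto)
qed

lemma J_negative_span: "n < 0 \<Longrightarrow> v \<in> span (range monomial) \<Longrightarrow> J i n v \<in> span (range monomial)"
proof (rule span_J_closed[where W = "range monomial"])
  fix w assume n: "n < 0" and "w \<in> range monomial"
  then obtain ws where w: "w = monomial ws" by blast
  have "J i n w = monomial ((i, nat (-1 - n)) # ws)" using n by (simp add: w)
  then show "J i n w \<in> span (range monomial)" by (metis rangeI span_base)
qed

lemma vac_span: "vac \<in> span (range monomial)"
  by (rule span_base) (metis monomial_simps(1) rangeI)

text \<open>Any mode is commuted past the first factor; the commutator acts on a shorter monomial.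
  No order on the factors is imposed, as only spanning is wanted.\<close>

lemma J_monomial_span: "J i n (monomial ws) \<in> span (range monomial)"
proof (induction ws arbitrary: i n)
  case Nil
  then show ?case
    using J_negative_span[of n vac i] vac_span
    by (cases "n < 0") (simp_all add: span_zero)
next
  case (Cons w ws)
  obtain j k where w: "w = (j, k)" by fastforce
  have "J j (-1 - int k) (J i n (monomial ws)) \<in> span (range monomial)"
    by (rule J_negative_span) (simp_all add: Cons)
  then show ?case
    by (simp add: w J_commutator[of i n j] span_add span_sum span_scale Cons span_base)
qed

lemma span_monomials: "v \<in> span (range monomial)"
proof (rule generated_J)
  show "vac \<in> span (range monomial)" by (rule vac_span)
  show "J i n v \<in> span (range monomial)" if "v \<in> span (range monomial)" for i n v
    using _ that by (rule span_J_closed) (auto simp: J_monomial_span)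
qed (rule subspace_span)

text \<open>
  Lagrange interpolation in \<open>L(0)\<close>: on vectors of weight less than \<open>K\<close> this is the projection
  to the weight space of weight \<open>m\<close>.
\<close>

primrec weight_projection :: "int \<Rightarrow> nat \<Rightarrow> 'v \<Rightarrow> 'v" where
  "weight_projection m 0 v = v"
| "weight_projection m (Suc k) v = (if int k = m then weight_projection m k v
     else smul (1 / of_int (m - int k)) (Y \<omega> 1 (weight_projection m k v) - smul (of_nat k) (weight_projection m k v)))"

lemma weight_projection_add:
    "weight_projection m K (v + w) = weight_projection m K v + weight_projection m K w"
  by (induction K) (simp_all add: Y_add_right scale_right_distrib scale_right_diff_distrib algebra_simps)

lemma weight_projection_scale:
    "weight_projection m K (smul c v) = smul c (weight_projection m K v)"
  by (induction K) (simp_all add: Y_scale_right scale_right_diff_distrib mult.commute)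

lemma weight_projection_eigenvector:
  assumes "Y \<omega> 1 v = smul (of_int n) v"
  shows "weight_projection m K v = smul (\<Prod>k | k < K \<and> int k \<noteq> m. of_int (n - int k) / of_int (m - int k)) v"
proof (induction K)
  case (Suc K)
  show ?case
  proof (cases "int K = m")
    case True
    then have "{k. k < Suc K \<and> int k \<noteq> m} = {k. k < K \<and> int k \<noteq> m}" by (auto simp: less_Suc_eq)
    with True Suc show ?thesis by simp
  next
    case False
    then have "{k. k < Suc K \<and> int k \<noteq> m} = insert K {k. k < K \<and> int k \<noteq> m}" by (auto simp: less_Suc_eq)
    with False show ?thesis
      by (simp add: Suc Y_scale_right assms mult.commute flip: scale_left_diff_distrib)
        (simp add: algebra_simps)
  qed
qed simp

text \<open>The interpolation polynomial in L(0) fixes \<open>v\<close>, kills monomials of other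
  weights below the bound and rescales those of weight \<open>m\<close>.\<close>

lemma weight_space:
  assumes v: "Y \<omega> 1 v = smul (of_int m) v"
  shows "v \<in> span (monomial ` {ws. int (weight ws) = m})"
proof -
  have "\<exists>K. v \<in> span (monomial ` {ws. weight ws < K})"
  proof -
    have mono: "span (monomial ` {ws. weight ws < K}) \<subseteq> span (monomial ` {ws. weight ws < K'})" if "K \<le> K'" for K K'
      using that by (intro span_mono) auto
    have "subspace {v. \<exists>K. v \<in> span (monomial ` {ws. weight ws < K})}"
    proof (rule subspaceI)
      fix x y assume "x \<in> {v. \<exists>K. v \<in> span (monomial ` {ws. weight ws < K})}"
        "y \<in> {v. \<exists>K. v \<in> span (monomial ` {ws. weight ws < K})}"
      then obtain K K' where "x \<in> span (monomial ` {ws. weight ws < K})"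
        "y \<in> span (monomial ` {ws. weight ws < K'})" by blast
      then have "x + y \<in> span (monomial ` {ws. weight ws < max K K'})"
        using mono[of K "max K K'"] mono[of K' "max K K'"] by (intro span_add) auto
      then show "x + y \<in> {v. \<exists>K. v \<in> span (monomial ` {ws. weight ws < K})}" by blast
    qed (auto intro: span_zero span_scale)
    with span_monomials[of v] show ?thesis
    proof (rule span_induct[where P = "\<lambda>v. \<exists>K. v \<in> span (monomial ` {ws. weight ws < K})"])
      fix x assume "x \<in> range monomial"
      then obtain ws where "x = monomial ws" by blast
      then show "\<exists>K. x \<in> span (monomial ` {ws. weight ws < K})"
        by (intro exI[of _ "Suc (weight ws)"] span_base) auto
    qed
  qed
  then obtain K where K: "v \<in> span (monomial ` {ws. weight ws < K})" by blast
  let ?S = "span (monomial ` {ws. int (weight ws) = m})"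
  have "subspace {v. weight_projection m K v \<in> ?S}"
    by (rule subspaceI)
      (auto simp: weight_projection_add weight_projection_scale weight_projection_eigenvector[of 0 0] intro: span_add span_scale span_zero)
  with K have "weight_projection m K v \<in> ?S"
  proof (rule span_induct[where P = "\<lambda>v. weight_projection m K v \<in> ?S"])
    fix x assume "x \<in> monomial ` {ws. weight ws < K}"
    then obtain ws where ws: "x = monomial ws" "weight ws < K" by blast
    have eq: "weight_projection m K x = smul (\<Prod>k | k < K \<and> int k \<noteq> m. of_int (int (weight ws) - int k) / of_int (m - int k)) x"
      by (rule weight_projection_eigenvector) (simp add: ws(1) omega_monomial)
    show "weight_projection m K x \<in> ?S"
    proof (cases "int (weight ws) = m")
      case True
      then show ?thesis unfolding eq using ws by (intro span_scale span_base) auto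
    next
      case False
      have "(\<Prod>k | k < K \<and> int k \<noteq> m. of_int (int (weight ws) - int k) / of_int (m - int k)) = (0 :: complex)"
        using False ws(2) by (intro prod_zero) auto
      then show ?thesis by (simp only: eq scale_zero_left span_zero)
    qed
  qed
  moreover have "weight_projection m K v = v"
  proof -
    have "(\<Prod>k | k < K \<and> int k \<noteq> m. of_int (m - int k) / of_int (m - int k)) = (1 :: complex)"
      by (rule prod.neutral) (simp del: of_int_diff)
    with weight_projection_eigenvector[OF v, of m K] show ?thesis by (simp only: scale_one)
  qed
  ultimately show ?thesis by simp
qed

lemma finite_weight: "finite {ws. int (weight ws) = n}"
proof (rule finite_subset)
  have "set ws \<subseteq> UNIV \<times> {..<weight ws}" for ws
    by (induction ws) fastforce+
  moreover have "length ws \<le> weight ws" for ws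
    by (induction ws) auto
  ultimately show "{ws. int (weight ws) = n} \<subseteq> {ws. set ws \<subseteq> UNIV \<times> {..<nat n} \<and> length ws \<le> nat n}"
    by fastforce
  show "finite {ws. set ws \<subseteq> (UNIV :: 3 set) \<times> {..<nat n} \<and> length ws \<le> nat n}"
    by (rule finite_lists_length_le) simp
qed

lemma omega_1_Q: "Y \<omega> 1 (Q A) = smul 2 (Q A)"
  by (simp add: Q_def Y_sum_right Y_scale_right omega_J J_scale scale_sum_right double_eq_scale mult.commute)

text \<open>L(1) sends this vector to the sum of A_ij [\<alpha>_i, \<alpha>_j](-1) vac, which
  vanishes by symmetry of \<open>A\<close>.\<close>

lemma omega_2_Q:
  assumes sym: "transpose A = A"
  shows "Y \<omega> 2 (Q A) = 0"
proof -
  have coefficient: "(\<Sum>i\<in>UNIV. \<Sum>j\<in>UNIV. A$i$j * structure_const i j k) = 0" for k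
    by (rule sum_symmetric_antisymmetric) (rule symmetric_entry[OF sym], rule structure_const_antisym)
  have "Y \<omega> 2 (Q A) = (\<Sum>i\<in>UNIV. \<Sum>j\<in>UNIV. \<Sum>k\<in>UNIV. smul (A$i$j * structure_const i j k) (J k (-1) vac))"
    by (simp add: Q_def Y_sum_right Y_scale_right omega_J J_current_0 scale_sum_right sum_negf)
  also have "\<dots> = (\<Sum>k\<in>UNIV. \<Sum>i\<in>UNIV. \<Sum>j\<in>UNIV. smul (A$i$j * structure_const i j k) (J k (-1) vac))"
    by (subst (2) sum.swap, subst sum.swap) simp
  also have "\<dots> = (\<Sum>k\<in>UNIV. smul (\<Sum>i\<in>UNIV. \<Sum>j\<in>UNIV. A$i$j * structure_const i j k) (J k (-1) vac))"
    by (simp add: scale_sum_left)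
  finally show ?thesis by (simp add: coefficient)
qed

text \<open>The grading axioms are read off from the monomials: none has negative weight, only the
  empty one has weight 0, and each weight has finitely many.\<close>

sublocale graded_vertex_algebra smul Y vac \<omega>
proof
  show "Y \<omega> 0 v = Y v (-2) vac" for v by (rule omega_zero_mode)
  show "Y \<omega> 1 \<omega> = smul 2 \<omega>" using omega_1_Q[of "mat (1 / (2 * (l + 2)))"] by (simp only: \<omega>_def[symmetric])
  show "v = 0" if "n < 0" "Y \<omega> 1 v = smul (of_int n) v" for n v
  proof -
    have "{ws. int (weight ws) = n} = {}" using that(1) by auto
    with weight_space[OF that(2)] show ?thesis by simp
  qed
  show "\<exists>c. v = smul c vac" if "Y \<omega> 1 v = 0" for v
  proof -
    have "weight ws = 0 \<Longrightarrow> ws = []" for ws by (cases ws) auto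
    then have "{ws. int (weight ws) = 0} = {[]}" by auto
    then show ?thesis using weight_space[of v 0] that by (auto simp: span_singleton)
  qed
  show "\<exists>B. finite B \<and> {v. Y \<omega> 1 v = smul (of_int n) v} \<subseteq> span B" for n
    using weight_space finite_weight by (intro exI[of _ "monomial ` {ws. int (weight ws) = n}"]) auto
qed

section \<open>The product of a quadratic vector with itself, and the classification\<close>

lemma quadratic_mode_1:
  assumes "\<And>p n. n \<ge> 2 \<Longrightarrow> J p n v = 0"
  shows "Y (J i (-1) (J j (-1) vac)) 1 v = J i (-1) (J j 1 v) + J j 0 (J i 0 v) + J j (-1) (J i 1 v)"
proof -
  have "Y (Y (\<iota> (alpha i)) (-1) (\<iota> (alpha j))) 1 v = (\<Sum>k<2. smul ((-1) ^ k * (of_int (-1) gchoose k))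
    (Y (\<iota> (alpha i)) (-1 - int k) (Y (\<iota> (alpha j)) (1 + int k) v)
      - smul ((-1) powi (-1)) (Y (\<iota> (alpha j)) (-1 + 1 - int k) (Y (\<iota> (alpha i)) (int k) v))))"
    by (rule mode_iterate) (simp_all add: assms[unfolded J_def])
  then show ?thesis
    using assms[of 2 j] by (simp add: numeral_2_eq_2 J_def)
qed

lemma Q_square:
  assumes sym: "transpose A = A"
  shows "Y (Q A) 1 (Q A) = Q (\<chi> i j. 4 * (l - 4) * (A ** A)$i$j + 16 * trace A * A$i$j
    - (if i = j then 4 * (trace A ^ 2 - trace (A ** A)) else 0))"
proof -
  \<comment> \<open>\<open>D\<close> records the action of the modes 1 and \<open>N\<close> that of
    pairs of zero modes; the product is the quadratic vector of 2 A D + N.\<close>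
  define D :: "complex ^ 3 ^ 3" where
    "D = (\<chi> p r. (2 * l - 2) * A$p$r + (if p = r then 2 * trace A else 0))"
  define N :: "complex ^ 3 ^ 3" where
    "N = (\<Sum>i\<in>UNIV. \<Sum>j\<in>UNIV. (\<chi> a b. A$i$j * (adjoint_action j (adjoint_action i A))$a$b))"
  have high: "n \<ge> 2 \<Longrightarrow> J p n (Q A) = 0" for p n
    using J_Q_2[OF sym] J_Q_high by (cases "n = 2") auto
  have D: "J p 1 (Q A) = (\<Sum>r\<in>UNIV. smul (D$p$r) (J r (-1) vac))" for p
    by (simp add: J_Q_1[OF sym] D_def)
  have "Y (Q A) 1 (Q A) = (\<Sum>i\<in>UNIV. \<Sum>j\<in>UNIV. smul (A$i$j) (Y (J i (-1) (J j (-1) vac)) 1 (Q A)))"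
    by (subst (1) Q_def) (simp add: Y_sum_left Y_scale_left)
  also have "\<dots> = (\<Sum>i\<in>UNIV. \<Sum>j\<in>UNIV. smul (A$i$j) (J i (-1) (J j 1 (Q A))))
    + (\<Sum>i\<in>UNIV. \<Sum>j\<in>UNIV. smul (A$i$j) (J j 0 (J i 0 (Q A))))
    + (\<Sum>i\<in>UNIV. \<Sum>j\<in>UNIV. smul (A$i$j) (J j (-1) (J i 1 (Q A))))"
    by (simp add: quadratic_mode_1[OF high] scale_right_distrib sum.distrib)
  also have "(\<Sum>i\<in>UNIV. \<Sum>j\<in>UNIV. smul (A$i$j) (J j (-1) (J i 1 (Q A))))
      = (\<Sum>i\<in>UNIV. \<Sum>j\<in>UNIV. smul (A$i$j) (J i (-1) (J j 1 (Q A))))"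
    by (subst sum.swap) (simp only: symmetric_entry[OF sym, of _ _])
  also have "(\<Sum>i\<in>UNIV. \<Sum>j\<in>UNIV. smul (A$i$j) (J i (-1) (J j 1 (Q A)))) = Q (A ** D)"
  proof -
    have "(\<Sum>i\<in>UNIV. \<Sum>j\<in>UNIV. smul (A$i$j) (J i (-1) (J j 1 (Q A))))
      = (\<Sum>i\<in>UNIV. \<Sum>j\<in>UNIV. \<Sum>r\<in>UNIV. smul (A$i$j * D$j$r) (J i (-1) (J r (-1) vac)))"
      by (simp add: D J_sum J_scale scale_sum_right)
    also have "\<dots> = (\<Sum>i\<in>UNIV. \<Sum>r\<in>UNIV. \<Sum>j\<in>UNIV. smul (A$i$j * D$j$r) (J i (-1) (J r (-1) vac)))"
      by (subst (2) sum.swap) simp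
    also have "\<dots> = Q (A ** D)"
      by (simp add: Q_def matrix_matrix_mult_def scale_sum_left)
    finally show ?thesis .
  qed
  also have "(\<Sum>i\<in>UNIV. \<Sum>j\<in>UNIV. smul (A$i$j) (J j 0 (J i 0 (Q A)))) = Q N"
    by (simp add: N_def J_Q_0 Q_sum Q_scale)
  finally have "Y (Q A) 1 (Q A) = Q (A ** D + N + A ** D)"
    by (simp only: Q_add)
  also have "A ** D + N + A ** D = (\<chi> i j. 4 * (l - 4) * (A ** A)$i$j + 16 * trace A * A$i$j
    - (if i = j then 4 * (trace A ^ 2 - trace (A ** A)) else 0))"
  proof -
    have AD: "(A ** D)$i$j = (2 * l - 2) * (A ** A)$i$j + 2 * trace A * A$i$j" for i j
    proof -
      have "(A ** D)$i$j = (\<Sum>k\<in>UNIV. (2 * l - 2) * (A$i$k * A$k$j) + (if k = j then 2 * trace A * A$i$k else 0))"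
        unfolding D_def matrix_matrix_mult_def by (simp, rule sum.cong) (auto simp: algebra_simps)
      then show ?thesis
        by (simp add: sum.distrib matrix_matrix_mult_def sum_distrib_left)
    qed
    have N: "N$i$j = - 12 * (A ** A)$i$j + 12 * trace A * A$i$j
        - (if i = j then 4 * (trace A ^ 2 - trace (A ** A)) else 0)" for i j
      using adjoint_action_twice[OF sym, of i j] by (simp add: N_def)
    show ?thesis
      by (simp add: vec_eq_iff AD N algebra_simps)
  qed
  finally show ?thesis .
qed

text \<open>Applying two modes 1 pairs \<open>Q A\<close> with all products of currents: (2l - 2)
  A_pq + 2 tr A on the diagonal must vanish. The sum over the diagonal is 2(l + 2) tr A, so the
  trace vanishes, and then (l - 1) A = 0.\<close>

lemma Q_eq_0:
  assumes "Q A = 0" and sym: "transpose A = A" and "vac \<noteq> 0" "l \<noteq> 0" "l \<noteq> 1"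
  shows "A = 0"
proof -
  have entry: "(2 * l - 2) * A$p$q + (if p = q then 2 * trace A else 0) = 0" for p q
  proof -
    have "0 = J q 1 (J p 1 (Q A))" by (simp add: assms(1))
    also have "\<dots> = (\<Sum>r\<in>UNIV. if q = r then smul (((2 * l - 2) * A$p$r + (if p = r then 2 * trace A else 0)) * l) vac else 0)"
      unfolding J_Q_1[OF sym] J_sum J_scale J_current_1 by (rule sum.cong) auto
    also have "\<dots> = smul (((2 * l - 2) * A$p$q + (if p = q then 2 * trace A else 0)) * l) vac"
      by simp
    finally show ?thesis using assms(3,4) by auto
  qed
  have "2 * ((l + 2) * trace A) = 0"
    using entry[of 1 1] entry[of 2 2] entry[of 3 3]
    unfolding trace_def sum_3 by (simp only: if_True refl simp_thms) algebra
  then have trace: "trace A = 0" using noncritical by simp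
  have "2 * (l - 1) * A$p$q = 0" for p q
    using entry[of p q] by (cases "p = q") (simp_all add: trace algebra_simps)
  then show ?thesis using assms(5) by (simp add: vec_eq_iff)
qed

text \<open>Monomials of weight 2 are \<alpha>_i(-2) vac and \<alpha>_i(-1) \<alpha>_j(-1) vac. The
  latter is its symmetrization plus half a commutator, which is again of the form x(-2) vac.\<close>

lemma weight_two_space:
  assumes "Y \<omega> 1 v = smul 2 v"
  obtains A x where "transpose A = A" "v = Q A + Y (\<iota> x) (-2) vac"
proof -
  let ?S = "{Q A + Y (\<iota> x) (-2) vac |A x. transpose A = A}"
  have sub: "subspace ?S"
  proof (rule subspaceI)
    show "0 \<in> ?S"
      by (intro CollectI exI[of _ 0]) (simp add: iota_zero transpose_def vec_eq_iff)
  next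
    fix v w assume "v \<in> ?S" "w \<in> ?S"
    then obtain A x B y where *: "transpose A = A" "v = Q A + Y (\<iota> x) (-2) vac"
      "transpose B = B" "w = Q B + Y (\<iota> y) (-2) vac" by blast
    have "transpose (A + B) = A + B"
      using symmetric_entry[OF *(1)] symmetric_entry[OF *(3)] by (simp add: transpose_def vec_eq_iff)
    moreover have "v + w = Q (A + B) + Y (\<iota> (x + y)) (-2) vac"
      by (simp add: * Q_add iota_add Y_add_left algebra_simps)
    ultimately show "v + w \<in> ?S" by blast
  next
    fix c v assume "v \<in> ?S"
    then obtain A x where *: "transpose A = A" "v = Q A + Y (\<iota> x) (-2) vac" by blast
    have "transpose (\<chi> i j. c * A$i$j) = (\<chi> i j. c * A$i$j)"
      using symmetric_entry[OF *(1)] by (simp add: transpose_def vec_eq_iff)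
    moreover have "smul c v = Q (\<chi> i j. c * A$i$j) + Y (\<iota> (c *s x)) (-2) vac"
      by (simp add: * Q_scale iota_scale Y_scale_left scale_right_distrib)
    ultimately show "smul c v \<in> ?S" by blast
  qed
  have "monomial ws \<in> ?S" if "weight ws = 2" for ws
  proof -
    obtain i k ws' where ws: "ws = (i, k) # ws'" using \<open>weight ws = 2\<close> by (cases ws) auto
    show ?thesis
    proof (cases ws')
      case Nil
      with ws \<open>weight ws = 2\<close> have "monomial ws = Q 0 + Y (\<iota> (alpha i)) (-2) vac" by (simp add: J_def)
      moreover have "transpose 0 = (0 :: complex ^ 3 ^ 3)" by (simp add: transpose_def vec_eq_iff)
      ultimately show ?thesis by blast
    next
      case (Cons w ws'')
      obtain j k' where w: "w = (j, k')" by fastforce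
      have "k = 0" "k' = 0" "weight ws'' = 0" using \<open>weight ws = 2\<close> by (simp_all add: ws Cons w)
      then have ws2: "ws = [(i, 0), (j, 0)]"
        unfolding ws Cons w by (cases ws'') auto
      \<comment> \<open>The symmetrized matrix unit (E_ij + E_ji)/2, as a sum of two terms so that i
        = j is covered as well.\<close>
      define A :: "complex ^ 3 ^ 3" where
        "A = (\<chi> a b. (if a = i then if b = j then 1 / 2 else 0 else 0) + (if a = j then if b = i then 1 / 2 else 0 else 0))"
      have sym: "transpose A = A"
        by (auto simp: A_def transpose_def vec_eq_iff)
      have if_sum: "(\<Sum>b\<in>UNIV. if P then f b else 0) = (if P then \<Sum>b\<in>UNIV. f b else 0)"
        for P and f :: "3 \<Rightarrow> 'v" by simp
      have "Q A = smul (1 / 2) (J i (-1) (J j (-1) vac)) + smul (1 / 2) (J j (-1) (J i (-1) vac))"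
        by (simp add: Q_def A_def scale_left_distrib sum.distrib if_distrib[of "\<lambda>x. smul x _"]
            if_sum cong: if_cong)
      also have "J j (-1) (J i (-1) vac) = J i (-1) (J j (-1) vac) - (\<Sum>k\<in>UNIV. smul (structure_const i j k) (J k (-2) vac))"
        by (subst (2) J_commutator) simp
      also have "(\<Sum>k\<in>UNIV. smul (structure_const i j k) (J k (-2) vac)) = Y (\<iota> (\<Sum>k\<in>UNIV. structure_const i j k *s alpha k)) (-2) vac"
        by (simp add: iota_sum iota_scale Y_sum_left Y_scale_left J_def)
      finally have "monomial ws = Q A + Y (\<iota> ((1 / 2) *s (\<Sum>k\<in>UNIV. structure_const i j k *s alpha k))) (-2) vac"
        by (simp add: ws2 iota_scale Y_scale_left scale_right_diff_distrib flip: scale_left_distrib)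
      with sym show ?thesis by blast
    qed
  qed
  then have "span (monomial ` {ws. int (weight ws) = 2}) \<subseteq> ?S"
    by (intro span_minimal sub) auto
  with weight_space[of v 2] assms have "v \<in> ?S" by auto
  then show thesis using that by blast
qed

lemma omega_2_descendant: "Y \<omega> 2 (Y (\<iota> x) (-2) vac) = smul 2 (\<iota> x)"
proof -
  have "Y \<omega> 2 (Y (\<iota> x) (-2) vac) = smul 2 (Y (\<iota> x) (-1) vac)"
    unfolding Y_iota[of x] by (simp add: Y_sum_right Y_scale_right omega_J scale_sum_right mult.commute)
  then show ?thesis by simp
qed

lemma semi_conformal_Q:
  assumes "semi_conformal_matrix l A"
  shows "Q A \<in> Sc smul UNIV Y vac \<omega>"
proof -
  have sym: "transpose A = A" using assms by (simp add: semi_conformal_matrix_def)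
  have "4 * (l - 4) * (A ** A)$i$j + 16 * trace A * A$i$j
    - (if i = j then 4 * (trace A ^ 2 - trace (A ** A)) else 0) = 2 * A$i$j" for i j
  proof -
    have "4 * (l - 4) * (A ** A)$i$j + (16 * trace A - 2) * A$i$j
      = (if i = j then 4 * (trace A ^ 2 - trace (A ** A)) else 0)"
      using assms by (simp add: semi_conformal_matrix_def)
    then show ?thesis by (simp add: algebra_simps)
  qed
  then have "Y (Q A) 1 (Q A) = smul 2 (Q A)"
    by (simp only: Q_square[OF sym] Q_scale)
  then show ?thesis
    by (simp add: semi_conformal_iff omega_1_Q omega_2_Q[OF sym])
qed

text \<open>L(1) eliminates the summand x(-2) vac, and injectivity of \<open>Q\<close> on symmetric
  matrices turns u_1 u = 2 u into the matrix equation.\<close>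

lemma semi_conformal_cases:
  assumes u: "u \<in> Sc smul UNIV Y vac \<omega>" and l: "l \<notin> {-2, 0, 1, 4}" and "vac \<noteq> 0"
  obtains A where "semi_conformal_matrix l A" "u = Q A"
proof -
  have u: "Y \<omega> 1 u = smul 2 u" "Y \<omega> 2 u = 0" "Y u 1 u = smul 2 u"
    using u by (simp_all add: semi_conformal_iff)
  obtain A x where sym: "transpose A = A" and A: "u = Q A + Y (\<iota> x) (-2) vac"
    using weight_two_space[OF u(1)] by blast
  have "\<iota> x = 0"
    using u(2) by (simp add: A Y_add_right omega_2_Q[OF sym] omega_2_descendant)
  then have uA: "u = Q A" by (simp add: A)
  define B :: "complex ^ 3 ^ 3" where "B = (\<chi> i j. 4 * (l - 4) * (A ** A)$i$j + 16 * trace A * A$i$j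
    - (if i = j then 4 * (trace A ^ 2 - trace (A ** A)) else 0))"
  define C :: "complex ^ 3 ^ 3" where "C = B + (\<chi> i j. (-2) * A$i$j)"
  have "Q C = 0"
  proof -
    have "Q B = smul 2 (Q A)" using u(3) by (simp only: uA Q_square[OF sym] B_def)
    moreover have "Q C = Q B + smul (-2) (Q A)" by (simp only: C_def Q_add Q_scale)
    ultimately show ?thesis by simp
  qed
  moreover have "transpose C = C"
  proof -
    have "transpose (A ** A) = A ** A" by (simp add: matrix_transpose_mul sym)
    from symmetric_entry[OF this] symmetric_entry[OF sym] show ?thesis
      by (simp add: C_def B_def transpose_def vec_eq_iff)
  qed
  ultimately have "C = 0" using Q_eq_0[of C] l \<open>vac \<noteq> 0\<close> by simp
  then have "C$i$j = 0" for i j by simp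
  then have "semi_conformal_matrix l A"
    unfolding semi_conformal_matrix_def C_def B_def using sym by (simp add: algebra_simps)
  then show thesis using uA that by blast
qed

lemma omega_orbit_image: "omega_orbit smul Y vac \<iota> A = Q ` {B. \<exists>R\<in>SO3. B = R ** A ** transpose R}"
  by (auto simp: omega_orbit_def Q_omega_mat)

lemma Sc_affine:
  assumes l: "l \<notin> {-2, 0, 1, 4}"
  shows "Sc smul UNIV Y vac (affine_omega smul Y vac l \<iota>) =
    omega_orbit smul Y vac \<iota> (A1 l) \<union> omega_orbit smul Y vac \<iota> (A4 l)
    \<union> {0} \<union> {affine_omega smul Y vac l \<iota>}" (is "_ = ?R")
proof -
  have l': "l \<noteq> 0" "l + 2 \<noteq> 0" using l noncritical by auto
  have orbit1: "omega_orbit smul Y vac \<iota> (A1 l) = {Q (axial_matrix (1 / (2 * l)) 0 v) |v :: complex ^ 3. (\<Sum>i\<in>UNIV. v$i * v$i) = 1}"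
    unfolding omega_orbit_image A1_def diag3_orbit by blast
  have orbit4: "omega_orbit smul Y vac \<iota> (A4 l) = {Q (axial_matrix (- 1 / (l * (l + 2))) (1 / (2 * (l + 2))) v) |v :: complex ^ 3. (\<Sum>i\<in>UNIV. v$i * v$i) = 1}"
    unfolding omega_orbit_image A4_def diag3_orbit by blast
  have zero: "Q (mat 0) = 0" by (simp add: Q_def mat_def)
  show ?thesis
  proof (intro equalityI subsetI)
    fix u assume u: "u \<in> Sc smul UNIV Y vac (affine_omega smul Y vac l \<iota>)"
    show "u \<in> ?R"
    proof (cases "vac = 0")
      case True
      \<comment> \<open>If the vacuum is 0, so is every vector, being created from it.\<close>
      then have "u = 0" using Y_creation[of u] by simp
      then show ?thesis by simp
    next
      case False
      obtain A where A: "semi_conformal_matrix l A" "u = Q A"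
        using semi_conformal_cases[OF u[unfolded affine_omega_eq] l False] by blast
      from A(1) l show ?thesis
      proof (cases rule: semi_conformal_matrix_cases)
        case (1 x)
        then show ?thesis using zero by (auto simp: A(2) affine_omega_eq \<omega>_def)
      next
        case (2 v)
        then show ?thesis unfolding orbit1 A(2) by blast
      next
        case (3 v)
        then show ?thesis unfolding orbit4 A(2) by blast
      qed
    qed
  next
    fix u assume "u \<in> ?R"
    then consider (o1) "u \<in> omega_orbit smul Y vac \<iota> (A1 l)" | (o4) "u \<in> omega_orbit smul Y vac \<iota> (A4 l)"
      | "u = 0" | "u = affine_omega smul Y vac l \<iota>" by blast
    then have "\<exists>A. semi_conformal_matrix l A \<and> u = Q A"
    proof cases
      case o1
      then obtain v :: "complex ^ 3" where v: "(\<Sum>i\<in>UNIV. v$i * v$i) = 1"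
        and u: "u = Q (axial_matrix (1 / (2 * l)) 0 v)"
        unfolding orbit1 by blast
      have "semi_conformal_matrix l (axial_matrix (1 / (2 * l)) 0 v)"
        using v by (rule semi_conformal_matrix_axial) (use l' in \<open>simp_all add: field_simps\<close>)
      with u show ?thesis by blast
    next
      case o4
      then obtain v :: "complex ^ 3" where v: "(\<Sum>i\<in>UNIV. v$i * v$i) = 1"
        and u: "u = Q (axial_matrix (- 1 / (l * (l + 2))) (1 / (2 * (l + 2))) v)"
        unfolding orbit4 by blast
      define x y where "x = - 1 / (l * (l + 2))" and "y = 1 / (2 * (l + 2))"
      have y: "2 * (l + 2) * y = 1"
        using l' divide_self[of "2 * (l + 2)"] by (simp add: y_def del: distrib_left_numeral)
      have "l * (l + 2) * x = -1" using l' by (simp add: x_def)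
      \<comment> \<open>The relation l x + 2 y = 0 between the eigenvalues of \<open>A4\<close>,
        together with the value of y, suffices for both eigenvalue equations.\<close>
      then have "(l + 2) * (l * x + 2 * y) = 0"
        using y[THEN diff_zeroI] diff_zeroI[of "l * (l + 2) * x" "-1"] by algebra
      then have x: "l * x + 2 * y = 0" using l' by simp
      have "semi_conformal_matrix l (axial_matrix x y v)"
        using v
      proof (rule semi_conformal_matrix_axial)
        show "4 * (l - 4) * (x + y) + 16 * (x + 2 * y) = 2"
          using x y[THEN diff_zeroI] by algebra
        show "4 * (l - 4) * (y * y) + (16 * (x + 2 * y) - 2) * y = 4 * (4 * x * y + 2 * y * y)"
          using x y[THEN diff_zeroI] by algebra
      qed
      with u show ?thesis unfolding x_def y_def by blast
    next
      case 3
      then show ?thesis using zero semi_conformal_matrix_scalar[of l 0] l by auto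
    next
      case 4
      then show ?thesis using semi_conformal_matrix_scalar[of l "1 / (2 * (l + 2))"] l
        by (auto simp: affine_omega_eq \<omega>_def)
    qed
    then show "u \<in> Sc smul UNIV Y vac (affine_omega smul Y vac l \<iota>)"
      using semi_conformal_Q by (auto simp: affine_omega_eq)
  qed
qed

end

section \<open>The universal affine vertex algebra\<close>

context universal_affine_vertex_algebra
begin

sublocale full_vertex_algebra smul Y vac ..

definition act :: "affine_gen list \<Rightarrow> 'v" where
  "act w = foldr (gen_act l smul Y \<iota>) w vac"

lemma act_simps [simp]:
  "act [] = vac" "act (Cur a n # w) = Y (\<iota> a) n (act w)" "act (Ctr # w) = smul l (act w)"
  by (simp_all add: act_def)

lemma vacuum_eval_superset:
  assumes "finite S" "Poly_Mapping.keys p \<subseteq> S"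
  shows "vacuum_eval l smul Y vac \<iota> p = (\<Sum>w\<in>S. smul (Poly_Mapping.lookup p w) (act w))"
  unfolding vacuum_eval_def act_def[symmetric]
  by (rule sum.mono_neutral_left) (use assms in \<open>auto simp: in_keys_iff\<close>)

lemma vacuum_eval_add:
  "vacuum_eval l smul Y vac \<iota> (p + q) = vacuum_eval l smul Y vac \<iota> p + vacuum_eval l smul Y vac \<iota> q"
proof -
  let ?S = "Poly_Mapping.keys p \<union> Poly_Mapping.keys q"
  show ?thesis
    using keys_add[of p q]
    by (simp add: vacuum_eval_superset[of ?S] lookup_add scale_left_distrib sum.distrib)
qed

lemma vacuum_eval_diff:
  "vacuum_eval l smul Y vac \<iota> (p - q) = vacuum_eval l smul Y vac \<iota> p - vacuum_eval l smul Y vac \<iota> q"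
  using vacuum_eval_add[of "p - q" q] by (simp add: algebra_simps)

lemma vacuum_eval_scale:
  "vacuum_eval l smul Y vac \<iota> (free_scale c p) = smul c (vacuum_eval l smul Y vac \<iota> p)"
proof -
  have "Poly_Mapping.keys (free_scale c p) \<subseteq> Poly_Mapping.keys p"
    by (auto simp: in_keys_iff lookup_free_scale)
  then show ?thesis
    by (simp add: vacuum_eval_superset[of "Poly_Mapping.keys p"] lookup_free_scale scale_sum_right)
qed

lemma vacuum_eval_word: "vacuum_eval l smul Y vac \<iota> (word w) = act w"
  by (simp add: vacuum_eval_superset[of "{w}"])

lemmas vacuum_eval_simps = vacuum_eval_diff vacuum_eval_scale vacuum_eval_word

lemma vacuum_eval_relation: "p \<in> vacuum_relations l \<Longrightarrow> vacuum_eval l smul Y vac \<iota> p = 0"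
  unfolding vacuum_eval_kernel vacuum_ideal_def
  using module.span_base[OF module_iff_vector_space[THEN iffD2, OF vector_space_free_scale]] .

lemma in_subspace:
  assumes "subspace S" "\<And>w. act w \<in> S"
  shows "v \<in> S"
proof -
  obtain p where "v = vacuum_eval l smul Y vac \<iota> p" using vacuum_eval_surj by blast
  then show ?thesis
    unfolding vacuum_eval_def act_def[symmetric]
    by (auto intro!: subspace_sum[OF assms(1)] subspace_scale[OF assms(1)] assms(2))
qed

text \<open>The defining relation with empty prefix, evaluated on the vacuum. The suffix
  \<open>w\<close> is arbitrary and the vectors \<open>act w\<close> span, so the identity extends
  to all vectors.\<close>

lemma act_linear:
  "Y (\<iota> (x *s a + y *s b)) n (act w) = smul x (Y (\<iota> a) n (act w)) + smul y (Y (\<iota> b) n (act w))"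
proof -
  have "word ([] @ [Cur (x *s a + y *s b) n] @ w)
      - free_scale x (word ([] @ [Cur a n] @ w)) - free_scale y (word ([] @ [Cur b n] @ w)) \<in> vacuum_relations l"
    unfolding vacuum_relations_def by (intro UnI1 CollectI exI conjI, rule refl, rule TrueI)
  from vacuum_eval_relation[OF this, unfolded vacuum_eval_simps append_Nil append_Cons act_simps] show ?thesis
    by (simp add: algebra_simps)
qed

lemma act_commutator:
  "Y (\<iota> a) m (Y (\<iota> b) n (act w)) - Y (\<iota> b) n (Y (\<iota> a) m (act w)) =
    Y (\<iota> (sl2_bracket a b)) (m + n) (act w)
    + smul (if m + n = 0 then of_int m * sl2_form a b * l else 0) (act w)"
proof -
  have "word ([] @ [Cur a m, Cur b n] @ w) - word ([] @ [Cur b n, Cur a m] @ w)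
        - word ([] @ [Cur (sl2_bracket a b) (m + n)] @ w)
        - free_scale (if m + n = 0 then of_int m * sl2_form a b else 0) (word ([] @ [Ctr] @ w)) \<in> vacuum_relations l"
    unfolding vacuum_relations_def
    by (rule UnI1, rule UnI1, rule UnI1, rule UnI2, intro CollectI exI conjI, rule refl, rule TrueI)
  from vacuum_eval_relation[OF this, unfolded vacuum_eval_simps append_Nil append_Cons act_simps] show ?thesis
    by (simp add: algebra_simps split: if_splits)
qed

lemma affine_vertex_algebra:
  assumes "l \<noteq> -2"
  shows "affine_vertex_algebra smul Y vac l \<iota>"
proof
  show "\<iota> (x *s a + y *s b) = smul x (\<iota> a) + smul y (\<iota> b)" for x a y b
    using act_linear[of x a y b "-1" "[]"] by simp
  show "Y (\<iota> a) m (Y (\<iota> b) n v) - Y (\<iota> b) n (Y (\<iota> a) m v) =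
      Y (\<iota> (sl2_bracket a b)) (m + n) v
      + smul (if m + n = 0 then of_int m * sl2_form a b * l else 0) v" for a m b n v
  proof -
    let ?S = "{v. Y (\<iota> a) m (Y (\<iota> b) n v) - Y (\<iota> b) n (Y (\<iota> a) m v) =
      Y (\<iota> (sl2_bracket a b)) (m + n) v
      + smul (if m + n = 0 then of_int m * sl2_form a b * l else 0) v}"
    have "v \<in> ?S"
    proof (rule in_subspace)
      show "subspace ?S"
      proof (rule subspaceI)
        fix x y assume "x \<in> ?S" "y \<in> ?S"
        then have "(Y (\<iota> a) m (Y (\<iota> b) n x) - Y (\<iota> b) n (Y (\<iota> a) m x)) + (Y (\<iota> a) m (Y (\<iota> b) n y) - Y (\<iota> b) n (Y (\<iota> a) m y))
          = (Y (\<iota> (sl2_bracket a b)) (m + n) x + smul (if m + n = 0 then of_int m * sl2_form a b * l else 0) x)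
          + (Y (\<iota> (sl2_bracket a b)) (m + n) y + smul (if m + n = 0 then of_int m * sl2_form a b * l else 0) y)"
          by (simp only: mem_Collect_eq)
        then show "x + y \<in> ?S"
          unfolding mem_Collect_eq Y_add_right scale_right_distrib by (simp only: add_diff_add ac_simps)
      next
        fix c x assume "x \<in> ?S"
        then show "smul c x \<in> ?S"
          by (simp only: mem_Collect_eq Y_scale_right scale_right_diff_distrib[symmetric] scale_right_distrib
              scale_left_commute[of _ c])
      qed simp
    qed (use act_commutator in blast)
    then show ?thesis by blast
  qed
  show "v \<in> S" if S: "subspace S" "vac \<in> S" "\<And>a n v. v \<in> S \<Longrightarrow> Y (\<iota> a) n v \<in> S" for S v
  proof (rule in_subspace[OF S(1)])
    show "act w \<in> S" for w
    proof (induction w)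
      case (Cons g w)
      then show ?case using S by (cases g) (auto intro: subspace_scale)
    qed (use S in simp)
  qed
  show "l + 2 \<noteq> 0" using assms by (auto simp: add_eq_0_iff2)
qed

end

section \<open>Passage to the simple quotient\<close>

lemma affine_vertex_algebra_quotient:
  assumes V: "affine_vertex_algebra smul Y vac l \<iota>"
    and W: "simple_quotient smul Y vac smul' Y' vac' \<pi>"
  shows "affine_vertex_algebra smul' Y' vac' l (\<pi> \<circ> \<iota>)"
proof -
  interpret V: affine_vertex_algebra smul Y vac l \<iota> by (rule V)
  interpret W: vertex_algebra smul' UNIV Y' vac' using W by (simp add: simple_quotient_def)
  interpret pi: Vector_Spaces.linear smul smul' \<pi> using W by (simp add: simple_quotient_def)
  have surj: "\<exists>v. w = \<pi> v" for w using W unfolding simple_quotient_def by (metis surjD)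
  have vac: "\<pi> vac = vac'" and mode: "\<pi> (Y u n v) = Y' (\<pi> u) n (\<pi> v)" for u n v
    using W by (simp_all add: simple_quotient_def)
  show ?thesis
  proof
    show "(\<pi> \<circ> \<iota>) (x *s a + y *s b) = smul' x ((\<pi> \<circ> \<iota>) a) + smul' y ((\<pi> \<circ> \<iota>) b)" for x a y b
      by (simp add: V.iota_linear pi.add pi.scale)
    show "Y' ((\<pi> \<circ> \<iota>) a) m (Y' ((\<pi> \<circ> \<iota>) b) n w) - Y' ((\<pi> \<circ> \<iota>) b) n (Y' ((\<pi> \<circ> \<iota>) a) m w) =
      Y' ((\<pi> \<circ> \<iota>) (sl2_bracket a b)) (m + n) w
      + smul' (if m + n = 0 then of_int m * sl2_form a b * l else 0) w" for a m b n w
    proof -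
      obtain v where w: "w = \<pi> v" using surj by blast
      show ?thesis
        using arg_cong[OF V.current_commutator[of a m b n v], of \<pi>]
        by (simp only: w o_apply pi.add pi.diff pi.scale mode)
    qed
    show "w \<in> S" if S: "W.subspace S" "vac' \<in> S" "\<And>a n v. v \<in> S \<Longrightarrow> Y' ((\<pi> \<circ> \<iota>) a) n v \<in> S" for S w
    proof -
      obtain v where w: "w = \<pi> v" using surj by blast
      \<comment> \<open>Generation passes to the quotient by pulling the subspace back along
        \<pi>.\<close>
      have "v \<in> {v. \<pi> v \<in> S}"
      proof (rule V.generated)
        show "V.subspace {v. \<pi> v \<in> S}"
          by (rule V.subspaceI)
            (simp_all add: pi.add pi.scale W.subspace_0[OF S(1)] W.subspace_add[OF S(1)] W.subspace_scale[OF S(1)])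
      qed (use S in \<open>simp_all add: vac mode\<close>)
      then show ?thesis by (simp add: w)
    qed
    show "l + 2 \<noteq> 0" by (rule V.noncritical)
  qed
qed

theorem corollary4p2:
  fixes l :: complex
    and smul :: "complex \<Rightarrow> 'v::ab_group_add \<Rightarrow> 'v"
    and Y :: "'v \<Rightarrow> int \<Rightarrow> 'v \<Rightarrow> 'v" and vac :: 'v and \<iota> :: "sl2 \<Rightarrow> 'v"
    and smul' :: "complex \<Rightarrow> 'w::ab_group_add \<Rightarrow> 'w"
    and Y' :: "'w \<Rightarrow> int \<Rightarrow> 'w \<Rightarrow> 'w" and vac' :: 'w and \<pi> :: "'v \<Rightarrow> 'w"
  assumes level: "l \<notin> {-2, 0, 1, 4}"
    and V: "universal_affine_vertex_algebra smul Y vac l \<iota>"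
  shows "Sc smul UNIV Y vac (affine_omega smul Y vac l \<iota>) =
           omega_orbit smul Y vac \<iota> (A1 l) \<union> omega_orbit smul Y vac \<iota> (A4 l)
           \<union> {0} \<union> {affine_omega smul Y vac l \<iota>}
       \<and> (\<forall>k::nat. k > 0 \<and> k \<notin> {1, 4} \<and> l = of_nat k
           \<and> simple_quotient smul Y vac smul' Y' vac' \<pi> \<longrightarrow>
           Sc smul' UNIV Y' vac' (\<pi> (affine_omega smul Y vac l \<iota>)) =
             \<pi> ` omega_orbit smul Y vac \<iota> (A1 l) \<union> \<pi> ` omega_orbit smul Y vac \<iota> (A4 l)
             \<union> {0} \<union> {\<pi> (affine_omega smul Y vac l \<iota>)})"
proof (intro conjI allI impI)
  have V': "affine_vertex_algebra smul Y vac l \<iota>"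
    using V by (rule universal_affine_vertex_algebra.affine_vertex_algebra) (use level in simp)
  then show "Sc smul UNIV Y vac (affine_omega smul Y vac l \<iota>) =
           omega_orbit smul Y vac \<iota> (A1 l) \<union> omega_orbit smul Y vac \<iota> (A4 l)
           \<union> {0} \<union> {affine_omega smul Y vac l \<iota>}"
    using level by (rule affine_vertex_algebra.Sc_affine)
  fix k :: nat
  assume "k > 0 \<and> k \<notin> {1, 4} \<and> l = of_nat k \<and> simple_quotient smul Y vac smul' Y' vac' \<pi>"
  then have W: "simple_quotient smul Y vac smul' Y' vac' \<pi>" by blast
  interpret pi: Vector_Spaces.linear smul smul' \<pi> using W by (simp add: simple_quotient_def)
  have vac: "\<pi> vac = vac'" and mode: "\<pi> (Y u n v) = Y' (\<pi> u) n (\<pi> v)" for u n v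
    using W by (simp_all add: simple_quotient_def)
  \<comment> \<open>Since \<pi> respects modes and vacuum, images of orbits and of \<omega> are the
    orbits and conformal vector built from the currents \<open>\<pi> \<circ> \<iota>\<close>, to
    which the classification applies directly.\<close>
  have "\<pi> (omega_mat smul Y vac \<iota> B) = omega_mat smul' Y' vac' (\<pi> \<circ> \<iota>) B" for B
    by (simp add: omega_mat_def pi.sum pi.scale mode vac)
  then have orbit: "\<pi> ` omega_orbit smul Y vac \<iota> A = omega_orbit smul' Y' vac' (\<pi> \<circ> \<iota>) A" for A
    by (auto simp: omega_orbit_def image_iff) metis+
  have omega: "\<pi> (affine_omega smul Y vac l \<iota>) = affine_omega smul' Y' vac' l (\<pi> \<circ> \<iota>)"
    by (simp add: affine_omega_def pi.sum pi.scale mode vac)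
  show "Sc smul' UNIV Y' vac' (\<pi> (affine_omega smul Y vac l \<iota>)) =
             \<pi> ` omega_orbit smul Y vac \<iota> (A1 l) \<union> \<pi> ` omega_orbit smul Y vac \<iota> (A4 l)
             \<union> {0} \<union> {\<pi> (affine_omega smul Y vac l \<iota>)}"
    unfolding orbit omega
    by (rule affine_vertex_algebra.Sc_affine[OF affine_vertex_algebra_quotient[OF V' W] level])
qed

end
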